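(* Let $n\ge3$ and $u\in C_c^2(\mathbb H^n\setminus\{0\})$. Then $$\|\Delta_{\mathbb H}u\|^2\ge\frac{(n-1)^4}{16}\|u\|^2+\frac{(n-1)^2}{8}\Big\|\frac u\rho\Big\|^2+\frac9{16}\Big\|\frac u{\rho^2}\Big\|^2+\frac{(n^2-1)(n-3)(n-5)}{16}\Big\|\frac u{(\sinh\rho)^2}\Big\|^2$$ $$+\frac{(n^2-1)(n-3)^2}{8}\Big\|\frac u{\sinh\rho}\Big\|^2+\frac{(n-1)(n-3)}{8}\Big\|\frac u{\rho\sinh\rho}\Big\|^2 .$$ In particular, $\|\Delta_{\mathbb H}u\|^2\ge\|u\|^2+\frac12\|u/\rho\|^2+\frac9{16}\|u/\rho^2\|^2$ for all $u\in C_c^2(\mathbb H^3\setminus\{0\})$, and $\|\Delta_{\mathbb H}u\|^2\ge\frac{81}{16}\|u\|^2+\frac98\|u/\rho\|^2+\frac{15}8\|u/\sinh\rho\|^2$ for all $u\in C_c^2(\mathbb H^4\setminus\{0\})$.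
   Context: $\mathbb H^n$ denotes the Poincaré ball model of hyperbolic space: the unit ball $\{x\in\mathbb R^n:|x|<1\}$ with metric $\frac{4|dx|^2}{(1-|x|^2)^2}$. Write $r=|x|$ and $\rho=\ln\frac{1+r}{1-r}$ (hyperbolic distance to the origin). $\Delta_{\mathbb H}$ is the Laplace–Beltrami operator of $\mathbb H^n$, and $\|\cdot\|$ is the norm of $L^2(\mathbb H^n)$ with respect to the hyperbolic volume measure. *)

theory Defs
  imports "HOL-Analysis.Analysis"
begin

text \<open>Poincare ball model: conformal factor of the metric 4|dx|^2/(1-|x|^2)^2.\<close>
definition conf :: "'a::euclidean_space \<Rightarrow> real" where
  "conf x = 2 / (1 - (norm x)\<^sup>2)"

text \<open>Hyperbolic distance to the origin.\<close>
definition hrho :: "'a::euclidean_space \<Rightarrow> real" where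
  "hrho x = ln ((1 + norm x) / (1 - norm x))"

definition pdir :: "('a::euclidean_space \<Rightarrow> real) \<Rightarrow> 'a \<Rightarrow> 'a \<Rightarrow> real" where
  "pdir f e y = deriv (\<lambda>s. f (y + s *\<^sub>R e)) 0"

text \<open>Laplace--Beltrami operator of the metric g = conf^2 |dx|^2 in the coordinates of the ball:
  Delta u = (sqrt det g)^(-1) sum_i d_i (sqrt det g * g^(ii) * d_i u),
  with sqrt det g = conf^n and g^(ii) = conf^(-2).\<close>
definition hyp_laplacian :: "('a::euclidean_space \<Rightarrow> real) \<Rightarrow> 'a \<Rightarrow> real" where
  "hyp_laplacian u x =
     inverse (conf x ^ DIM('a)) *
     (\<Sum>b\<in>Basis. pdir (\<lambda>y. conf y ^ DIM('a) * inverse ((conf y)\<^sup>2) * pdir u b y) b x)"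

text \<open>Squared L^2 norm with respect to the hyperbolic volume measure conf^n dx on the ball.\<close>
definition hnorm2 :: "('a::euclidean_space \<Rightarrow> real) \<Rightarrow> real" where
  "hnorm2 f = (LINT x : ball 0 1 | lborel. (f x)\<^sup>2 * conf x ^ DIM('a))"

definition C2_on :: "'a::euclidean_space set \<Rightarrow> ('a \<Rightarrow> real) \<Rightarrow> bool" where
  "C2_on S u \<longleftrightarrow> (\<exists>D :: 'a \<Rightarrow> ('a \<Rightarrow>\<^sub>L real). \<exists>D2 :: 'a \<Rightarrow> ('a \<Rightarrow>\<^sub>L ('a \<Rightarrow>\<^sub>L real)).
      (\<forall>x\<in>S. (u has_derivative blinfun_apply (D x)) (at x)) \<and>
      (\<forall>x\<in>S. (D has_derivative blinfun_apply (D2 x)) (at x)) \<and>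
      continuous_on S D2)"

text \<open>u is in C_c^2(H^n minus {0}): C^2 on the punctured ball, with support (closure of the
  nonzero set) compact and contained in the punctured ball (so u vanishes near 0 and near the
  boundary sphere, and outside the ball).\<close>
definition C2c_punct :: "('a::euclidean_space \<Rightarrow> real) \<Rightarrow> bool" where
  "C2c_punct u \<longleftrightarrow> C2_on (ball 0 1 - {0}) u \<and>
     compact (closure {x. u x \<noteq> 0}) \<and> closure {x. u x \<noteq> 0} \<subseteq> ball 0 1 - {0}"

end

theory Submission
  imports Defs
begin

text \<open>
  Let \<open>\<rho>\<close> be the distance to the origin, \<open>n\<close> the dimension and \<open>c = (n - 1) / 2\<close>. The twisted radial
  derivative \<open>T = \<partial>\<^sub>\<rho> + c coth \<rho>\<close>, which is \<open>\<partial>\<^sub>\<rho>\<close> conjugated by \<open>(sinh \<rho>)\<^sup>c\<close>, is skew-adjoint for the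
  hyperbolic volume, and
  \<open>\<Delta>u = T\<^sup>2 u - (c\<^sup>2 + (c\<^sup>2 - c) / sinh\<^sup>2 \<rho>) u + \<Lambda>u / sinh\<^sup>2 \<rho>\<close>, where \<open>\<Lambda>\<close> is the spherical Laplacian,
  the sum of the squares of the rotation fields. Expanding \<open>\<parallel>\<Delta>u\<parallel>\<^sup>2\<close>, the purely radial part gives
  exactly the stated bound after integration by parts and three one-dimensional Hardy inequalities,
  one of them with weight \<open>1 / sinh\<^sup>2 \<rho>\<close>.
  The mixed terms are treated by the same weighted Hardy inequality applied to the rotational
  derivatives of \<open>u\<close>; together with \<open>\<parallel>\<Lambda>u / sinh\<^sup>2 \<rho>\<parallel>\<^sup>2\<close> they are nonnegative. For \<open>n \<ge> 4\<close> this
  follows from \<open>\<rho> \<le> sinh \<rho>\<close>, whereas \<open>n = 3\<close> needs the spectral gap of the 2-sphere, in Bochner's form.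
  Polar coordinates are avoided: all integrations by parts are along vector fields on the ball, and
  those that would formally involve third derivatives of \<open>u\<close> are justified by difference quotients.
\<close>

section \<open>Integration by parts for compactly supported functions\<close>

text \<open>The twist is chosen so that the drift \<open>(n - 1) coth \<rho>\<close> of the volume
  disappears: for \<open>T\<close> radial integration by parts reads as on a line with flat measure,
  and a weighted Hardy inequality is a completed square. Squaring \<open>coth \<rho>\<close> in
  \<open>T\<^sup>2\<close> leaves the potential \<open>a + b / sinh\<^sup>2 \<rho>\<close> with
  \<open>a = c\<^sup>2\<close> and \<open>b = c\<^sup>2 - c\<close>; the six coefficients of the
  theorem are \<open>a\<^sup>2\<close>, \<open>a / 2\<close>, \<open>9 / 16\<close>,
  \<open>b\<^sup>2 - 2 b\<close>, \<open>2 a b - 2 b\<close> and \<open>b / 2\<close>. The mixed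
  terms are tractable because \<open>T\<close> commutes with every rotation field \<open>A\<close>:
  the product of \<open>T\<^sup>2 u\<close> and \<open>A\<^sup>2 u\<close> turns into the square of
  \<open>T A u\<close>. This exchanges two first-order operators between \<open>T u\<close> and
  \<open>A u\<close>, which are only of class C^1; hence the exchange of directions is an identity
  of its own, free of second derivatives of its arguments. The weight left on the square of
  \<open>A u\<close> contains \<open>(2 b - 2) / sinh\<^sup>4 \<rho>\<close>, negative in dimensions
  3 and 4, and this is the obstacle that separates the low dimensions.\<close>

definition C1c :: "'a::euclidean_space set \<Rightarrow> ('a \<Rightarrow> real) \<Rightarrow> ('a \<Rightarrow> 'a \<Rightarrow> real) \<Rightarrow> bool" where
  "C1c K f f' \<longleftrightarrow> (\<forall>x. (f has_derivative f' x) (at x)) \<and> (\<forall>v. continuous_on UNIV (\<lambda>x. f' x v)) \<and>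
     (\<forall>x. x \<notin> K \<longrightarrow> f x = 0 \<and> f' x = (\<lambda>_. 0))"

text \<open>\<open>C1c\<close> is global and vanishes off \<open>K\<close>, so all integrals run
  over the whole space without boundary terms; \<open>C1on\<close> is for coefficients such as
  \<open>coth_rho\<close>, which are singular outside \<open>S\<close>. Continuity of the derivative
  is asked direction by direction, which avoids operator norms.\<close>

definition C1on :: "'a::euclidean_space set \<Rightarrow> ('a \<Rightarrow> real) \<Rightarrow> ('a \<Rightarrow> 'a \<Rightarrow> real) \<Rightarrow> bool" where
  "C1on S f f' \<longleftrightarrow> (\<forall>x\<in>S. (f has_derivative f' x) (at x)) \<and> (\<forall>v. continuous_on S (\<lambda>x. f' x v))"

definition Cc :: "'a::euclidean_space set \<Rightarrow> ('a \<Rightarrow> real) \<Rightarrow> bool" where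
  "Cc K f \<longleftrightarrow> continuous_on K f \<and> (\<forall>x. x \<notin> K \<longrightarrow> f x = 0)"

lemma Cc_integrable:
  assumes "compact K" "Cc K f"
  shows "integrable lborel f"
proof -
  have "integrable lborel (\<lambda>x. indicator K x *\<^sub>R f x)"
    using assms by (intro borel_integrable_compact) (auto simp: Cc_def)
  moreover have "(\<lambda>x. indicator K x *\<^sub>R f x) = f"
    using assms by (intro ext) (auto simp: Cc_def indicator_def)
  ultimately show ?thesis by simp
qed

lemma Cc_mult: "\<lbrakk>Cc K f; continuous_on K g\<rbrakk> \<Longrightarrow> Cc K (\<lambda>x. f x * g x)"
  by (auto simp: Cc_def intro!: continuous_intros)

lemma Cc_mult2: "\<lbrakk>Cc K f; continuous_on K g\<rbrakk> \<Longrightarrow> Cc K (\<lambda>x. g x * f x)"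
  by (auto simp: Cc_def intro!: continuous_intros)

lemma C1c_has_derivative: "C1c K f f' \<Longrightarrow> (f has_derivative f' x) (at x)"
  by (simp add: C1c_def)

lemma C1c_continuous: "C1c K f f' \<Longrightarrow> continuous_on A f"
  by (meson C1c_def has_derivative_continuous continuous_at_imp_continuous_on)

lemma C1c_deriv_continuous: "C1c K f f' \<Longrightarrow> continuous_on A (\<lambda>x. f' x v)"
  using continuous_on_subset[of UNIV] by (auto simp: C1c_def)

lemma C1c_Cc: "C1c K f f' \<Longrightarrow> Cc K f"
  by (auto simp: Cc_def C1c_continuous) (simp add: C1c_def)

lemma C1c_linear: "C1c K f f' \<Longrightarrow> linear (f' x)"
  by (meson C1c_def has_derivative_linear)

lemma C1c_deriv_Cc: "C1c K f f' \<Longrightarrow> Cc K (\<lambda>x. f' x v)"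
  by (auto simp: Cc_def C1c_deriv_continuous) (simp add: C1c_def)

lemma C1c_deriv_basis:
  assumes "C1c K f f'"
  shows "f' x v = (\<Sum>b\<in>Basis. (v \<bullet> b) * f' x b)"
proof -
  have "f' x (\<Sum>b\<in>Basis. (v \<bullet> b) *\<^sub>R b) = (\<Sum>b\<in>Basis. (v \<bullet> b) * f' x b)"
    using C1c_linear[OF assms, of x] by (simp add: linear_sum linear_scale)
  then show ?thesis by (simp add: euclidean_representation)
qed

lemma C1c_deriv_field_Cc:
  assumes "C1c K f f'" "continuous_on K X"
  shows "Cc K (\<lambda>x. f' x (X x))"
proof -
  have "continuous_on K (\<lambda>x. \<Sum>b\<in>Basis. (X x \<bullet> b) * f' x b)"
    using assms by (intro continuous_intros C1c_deriv_continuous[OF assms(1)])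
  then have "continuous_on K (\<lambda>x. f' x (X x))"
    by (simp flip: C1c_deriv_basis[OF assms(1)])
  with assms show ?thesis by (auto simp: Cc_def) (simp add: C1c_def)
qed

text \<open>Makes singular coefficients usable: \<open>g\<close> may be arbitrary outside
  \<open>S\<close>, because the product vanishes on the open set \<open>-K\<close>, and
  \<open>S\<close> and \<open>-K\<close> cover the space.\<close>

lemma C1c_mult_C1on:
  assumes f: "C1c K f f'" and g: "C1on S g g'" and K: "compact K" "K \<subseteq> S" "open S"
  shows "C1c K (\<lambda>x. g x * f x) (\<lambda>x v. g x * f' x v + g' x v * f x)"
  unfolding C1c_def
proof (intro conjI allI impI)
  have cl: "closed K" using K by (simp add: compact_imp_closed)
  have z: "f x = 0" "f' x v = 0" if "x \<notin> K" for x v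
    using f that by (auto simp: C1c_def)
  show "((\<lambda>x. g x * f x) has_derivative (\<lambda>v. g x * f' x v + g' x v * f x)) (at x)" for x
  proof (cases "x \<in> S")
    case True
    then show ?thesis using f g
      by (auto simp: C1c_def C1on_def intro!: has_derivative_mult)
  next
    case False
    then have nK: "x \<in> - K" using K by auto
    have "((\<lambda>x. 0) has_derivative (\<lambda>v. 0)) (at x)" by simp
    then have "((\<lambda>x. g x * f x) has_derivative (\<lambda>v. 0)) (at x)"
      by (rule has_derivative_transform_within_open[where s="-K"]) (use nK cl z in auto)
    then show ?thesis using z nK by simp
  qed
  show "continuous_on UNIV (\<lambda>x. g x * f' x v + g' x v * f x)" for v
  proof -
    have gc: "continuous_on S g"
      using g by (meson C1on_def has_derivative_continuous continuous_at_imp_continuous_on)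
    have "continuous_on S (\<lambda>x. g x * f' x v + g' x v * f x)"
      using gc g by (auto intro!: continuous_intros C1c_deriv_continuous[OF f] C1c_continuous[OF f] simp: C1on_def)
    moreover have "continuous_on (-K) (\<lambda>x. g x * f' x v + g' x v * f x)"
      by (rule continuous_on_eq[where f="\<lambda>x. 0"]) (use z in auto)
    ultimately have "continuous_on (S \<union> -K) (\<lambda>x. g x * f' x v + g' x v * f x)"
      using K cl by (intro continuous_on_open_Un) auto
    moreover have "S \<union> -K = UNIV" using K by auto
    ultimately show ?thesis by simp
  qed
qed (use f in \<open>auto simp: C1c_def\<close>)

lemma C1c_imp_C1on: "C1c K f f' \<Longrightarrow> C1on S f f'"
  by (auto simp: C1on_def C1c_def intro: continuous_on_subset)

lemma C1c_mult:
  assumes "C1c K f f'" "C1c K g g'" "compact K"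
  shows "C1c K (\<lambda>x. g x * f x) (\<lambda>x v. g x * f' x v + g' x v * f x)"
  using C1c_mult_C1on[OF assms(1) C1c_imp_C1on[OF assms(2), of UNIV]] assms by auto

lemma Cc_bounded:
  assumes "compact K" "Cc K f"
  shows "\<exists>B\<ge>0. \<forall>x. \<bar>f x\<bar> \<le> B"
proof -
  have "compact (f ` K)" using assms by (auto simp: Cc_def intro: compact_continuous_image)
  then obtain B where "\<forall>y\<in>f ` K. norm y \<le> B"
    by (meson bounded_iff compact_imp_bounded)
  then have "\<forall>x. \<bar>f x\<bar> \<le> max B 0"
    using assms(2) by (metis Cc_def image_eqI abs_zero max.cobounded2 max.coboundedI1 real_norm_def)
  then show ?thesis by (meson max.cobounded2)
qed

section \<open>Difference quotients and dominated convergence\<close>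

lemma line_has_derivative:
  fixes f :: "'a::euclidean_space \<Rightarrow> real"
  assumes "\<And>x. (f has_derivative f' x) (at x)"
  shows "((\<lambda>t::real. f (x + t *\<^sub>R e)) has_derivative (\<lambda>s. s * f' (x + t *\<^sub>R e) e)) (at t)"
proof -
  have "((\<lambda>t. x + t *\<^sub>R e) has_derivative (\<lambda>s. s *\<^sub>R e)) (at t)"
    by (auto intro!: derivative_eq_intros)
  from has_derivative_compose[OF this assms]
  have "((\<lambda>t. f (x + t *\<^sub>R e)) has_derivative (\<lambda>s. f' (x + t *\<^sub>R e) (s *\<^sub>R e))) (at t)" .
  moreover have "f' y (s *\<^sub>R e) = s * f' y e" for s y
    using has_derivative_linear[OF assms[of y]] by (simp add: linear_scale)
  ultimately show ?thesis by simp
qed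

lemma line_mvt:
  fixes f :: "'a::euclidean_space \<Rightarrow> real"
  assumes "\<And>x. (f has_derivative f' x) (at x)" "h > 0"
  shows "\<exists>t. 0 < t \<and> t < h \<and> f (x + h *\<^sub>R e) - f x = h * f' (x + t *\<^sub>R e) e"
proof -
  have "\<exists>t\<in>{0<..<h}. f (x + h *\<^sub>R e) - f (x + 0 *\<^sub>R e) = (h - 0) * f' (x + t *\<^sub>R e) e"
    by (rule mvt_simple[OF assms(2)])
      (use line_has_derivative[OF assms(1)] has_derivative_at_withinI in blast)
  then show ?thesis by auto
qed

text \<open>The step \<open>1 / (k + 1)\<close> is never 0 and at most 1: the quotients form a
  sequence, as dominated convergence wants, and their supports stay in one fixed ball.\<close>

definition dq :: "('a::euclidean_space \<Rightarrow> real) \<Rightarrow> 'a \<Rightarrow> nat \<Rightarrow> 'a \<Rightarrow> real" where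
  "dq f e k x = (f (x + inverse (real (Suc k)) *\<^sub>R e) - f x) * real (Suc k)"

lemma dq_bound:
  assumes "compact K" "C1c K f f'"
  shows "\<exists>B M. 0 \<le> B \<and> (\<forall>k x. \<bar>dq f e k x\<bar> \<le> B * indicator (cball 0 M) x)"
proof -
  obtain B where B: "B \<ge> 0" "\<And>x. \<bar>f' x e\<bar> \<le> B"
    using Cc_bounded[OF assms(1) C1c_deriv_Cc[OF assms(2)]] by metis
  obtain M where M: "\<And>x. x \<in> K \<Longrightarrow> norm x \<le> M"
    using assms(1) by (meson bounded_iff compact_imp_bounded)
  \<comment> \<open>A point whose translate by at most \<open>norm e\<close> lies in
    \<open>K\<close> has norm at most \<open>M + norm e\<close>; hence a radius independent of
    \<open>k\<close>.\<close>
  have "\<bar>dq f e k x\<bar> \<le> B * indicator (cball 0 (M + norm e)) x" for k x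
  proof (cases "x \<in> cball 0 (M + norm e)")
    case True
    obtain t where "f (x + inverse (real (Suc k)) *\<^sub>R e) - f x = inverse (real (Suc k)) * f' (x + t *\<^sub>R e) e"
      using line_mvt[OF C1c_has_derivative[OF assms(2)], of "inverse (real (Suc k))" x e] by auto
    then have "dq f e k x = f' (x + t *\<^sub>R e) e" by (simp add: dq_def)
    then show ?thesis using B True by (simp add: indicator_def)
  next
    case False
    have "norm x \<le> norm (x + inverse (real (Suc k)) *\<^sub>R e) + norm (inverse (real (Suc k)) *\<^sub>R e)"
      by (metis add_diff_cancel_right' norm_triangle_ineq4)
    also have "norm (inverse (real (Suc k)) *\<^sub>R e) \<le> norm e"
      by (simp add: divide_simps mult_le_cancel_left1)
    finally have "x + inverse (real (Suc k)) *\<^sub>R e \<notin> K" "x \<notin> K"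
      using False M norm_ge_zero[of e] by (force simp del: norm_ge_zero)+
    then have "dq f e k x = 0" using assms(2) by (simp add: dq_def C1c_def)
    then show ?thesis using B by simp
  qed
  then show ?thesis using B by blast
qed

lemma dq_tendsto:
  assumes "C1c K f f'"
  shows "(\<lambda>k. dq f e k x) \<longlonglongrightarrow> f' x e"
proof -
  have "((\<lambda>t. f (x + t *\<^sub>R e)) has_derivative (\<lambda>s. s * f' (x + 0 *\<^sub>R e) e)) (at 0)"
    by (rule line_has_derivative) (rule C1c_has_derivative[OF assms])
  then have "((\<lambda>t. f (x + t *\<^sub>R e)) has_field_derivative f' x e) (at 0)"
    by (simp add: has_field_derivative_def mult.commute[of _ "f' x e"] cong: )
  then have "((\<lambda>h. (f (x + h *\<^sub>R e) - f x) / h) \<longlongrightarrow> f' x e) (at 0)"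
    by (simp add: DERIV_def)
  moreover have "filterlim (\<lambda>k. inverse (real (Suc k))) (at 0) sequentially"
    using LIMSEQ_inverse_real_of_nat by (auto simp: filterlim_at)
  ultimately have "(\<lambda>k. (f (x + inverse (real (Suc k)) *\<^sub>R e) - f x) / inverse (real (Suc k))) \<longlonglongrightarrow> f' x e"
    by (rule filterlim_compose)
  then show ?thesis by (simp add: dq_def divide_inverse)
qed

lemma integral_translate:
  fixes f :: "'a::euclidean_space \<Rightarrow> real"
  assumes "f \<in> borel_measurable borel"
  shows "(\<integral>x. f (x + a) \<partial>lborel) = (\<integral>x. f x \<partial>lborel)"
proof -
  have "(\<integral>x. f x \<partial>lborel) = (\<integral>x. f x \<partial>distr lborel borel ((+) a))"
    by (simp add: lborel_distr_plus)
  also have "\<dots> = (\<integral>x. f (a + x) \<partial>lborel)"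
    using assms by (intro integral_distr) auto
  finally show ?thesis by (simp add: add.commute)
qed

lemma integrable_translate:
  fixes f :: "'a::euclidean_space \<Rightarrow> real"
  assumes "integrable lborel f"
  shows "integrable lborel (\<lambda>x. f (x + a))"
proof -
  have "integrable (distr lborel borel ((+) a)) f" using assms by (simp add: lborel_distr_plus)
  then have "integrable lborel (\<lambda>x. f (a + x))"
    by (subst (asm) integrable_distr_eq) (use assms in auto)
  then show ?thesis by (simp add: add.commute)
qed

lemma dq_limit_integral:
  assumes K: "compact K" and f: "C1c K f f'" and gc: "continuous_on UNIV g"
  shows "(\<lambda>k. \<integral>x. dq f e k x * g x \<partial>lborel) \<longlonglongrightarrow> (\<integral>x. f' x e * g x \<partial>lborel)"
proof -
  obtain B M where B: "B \<ge> 0" "\<And>k x. \<bar>dq f e k x\<bar> \<le> B * indicator (cball 0 M) x"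
    using dq_bound[OF K f] by blast
  have fc: "continuous_on UNIV f" using C1c_continuous[OF f] .
  have [measurable]: "f \<in> borel_measurable borel" "g \<in> borel_measurable borel" "(\<lambda>x. f' x e) \<in> borel_measurable borel"
    using gc fc C1c_deriv_continuous[OF f] by (auto intro: borel_measurable_continuous_onI)
  have [measurable]: "(\<lambda>x. dq f e k x) \<in> borel_measurable borel" for k
    unfolding dq_def by measurable
  show ?thesis
  proof (rule integral_dominated_convergence[where w="\<lambda>x. indicator (cball 0 M) x *\<^sub>R (B * \<bar>g x\<bar>)"])
    show "integrable lborel (\<lambda>x. indicator (cball 0 M) x *\<^sub>R (B * \<bar>g x\<bar>))"
      by (rule borel_integrable_compact) (auto intro!: continuous_intros continuous_on_subset[OF gc])
    show "AE x in lborel. norm (dq f e k x * g x) \<le> indicator (cball 0 M) x *\<^sub>R (B * \<bar>g x\<bar>)" for k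
      using mult_right_mono[OF B(2) abs_ge_zero] by (auto simp: abs_mult mult_ac)
    show "AE x in lborel. (\<lambda>k. dq f e k x * g x) \<longlonglongrightarrow> f' x e * g x"
      by (intro AE_I2 tendsto_mult dq_tendsto[OF f] tendsto_const)
  qed measurable
qed

text \<open>Translation invariance makes the integral of every difference quotient zero, and
  dominated convergence passes to the derivative.\<close>

lemma C1c_integral_deriv:
  assumes K: "compact K" and f: "C1c K f f'"
  shows "(\<integral>x. f' x e \<partial>lborel) = 0"
proof -
  have int: "integrable lborel f" by (rule Cc_integrable[OF K C1c_Cc[OF f]])
  have [measurable]: "f \<in> borel_measurable borel"
    using C1c_continuous[OF f] by (auto intro: borel_measurable_continuous_onI)
  have "(\<integral>x. dq f e k x * 1 \<partial>lborel) = 0" for k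
    using integral_translate[of f "inverse (real (Suc k)) *\<^sub>R e"] integrable_translate[OF int] int
    by (simp add: dq_def)
  moreover have "(\<lambda>k. \<integral>x. dq f e k x * 1 \<partial>lborel) \<longlonglongrightarrow> (\<integral>x. f' x e * 1 \<partial>lborel)"
    by (rule dq_limit_integral[OF K f continuous_on_const])
  ultimately have "(\<lambda>k. 0::real) \<longlonglongrightarrow> (\<integral>x. f' x e * 1 \<partial>lborel)" by simp
  then show ?thesis by (simp add: LIMSEQ_const_iff)
qed

text \<open>The formal proof moves one derivative from \<open>g\<close> to \<open>f\<close> and back, which needs second
  derivatives; replacing one of the two by a difference quotient makes \<open>C\<^sup>1\<close> enough.\<close>
lemma integral_swap_directions:
  assumes K: "compact K" and f: "C1c K f f'" and g: "C1c K g g'"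
  shows "(\<integral>x. f' x a * g' x b \<partial>lborel) = (\<integral>x. f' x b * g' x a \<partial>lborel)"
proof -
  have step: "(\<integral>x. dq g b k x * f' x a \<partial>lborel) = - (\<integral>x. dq f (-b) k x * g' x a \<partial>lborel)" for k
  proof -
    define h where "h = inverse (real (Suc k)) *\<^sub>R b"
    define m where "m = real (Suc k)"
    \<comment> \<open>\<open>G\<close> is the forward difference quotient of \<open>g\<close> along
      \<open>b\<close>. It is still of class C^1, so it may be integrated by parts against
      \<open>f\<close> in direction \<open>a\<close>.\<close>
    define G where "G x = g (x + h) * m - g x * m" for x
    define G' where "G' x v = g' (x + h) v * m - g' x v * m" for x v
    have dG: "C1on UNIV G G'"
      unfolding C1on_def
    proof (intro conjI allI ballI)
      have 1: "((\<lambda>x. g (x + h)) has_derivative (\<lambda>v. g' (x + h) v)) (at x)" for x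
        by (rule has_derivative_compose[OF _ C1c_has_derivative[OF g], of "\<lambda>x. x + h" "\<lambda>v. v" for x, simplified])
           (auto intro!: derivative_eq_intros)
      show "(G has_derivative G' x) (at x)" for x
        unfolding G_def G'_def
        by (intro has_derivative_diff has_derivative_mult_left 1 C1c_has_derivative[OF g])
      have "continuous_on UNIV (\<lambda>x. g' (x + h) v)" for v
        by (rule continuous_on_compose2[of UNIV "\<lambda>x. g' x v" _ "\<lambda>x. x + h"])
          (auto intro!: continuous_intros C1c_deriv_continuous[OF g])
      then show "continuous_on UNIV (\<lambda>x. G' x v)" for v
        unfolding G'_def by (intro continuous_intros C1c_deriv_continuous[OF g])
    qed
    note P = C1c_mult_C1on[OF f dG K, simplified]
    have Gc: "continuous_on A G" for A
      using dG by (meson C1on_def UNIV_I has_derivative_continuous continuous_at_imp_continuous_on)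
    have i: "integrable lborel (\<lambda>x. G x * f' x a)" "integrable lborel (\<lambda>x. G' x a * f x)"
      using dG by (auto intro!: Cc_integrable[OF K] Cc_mult2 C1c_deriv_Cc[OF f] C1c_Cc[OF f] Gc
            intro: continuous_on_subset simp: C1on_def)
    have "(\<integral>x. G x * f' x a + G' x a * f x \<partial>lborel) = 0"
      by (rule C1c_integral_deriv[OF K P])
    then have 1: "(\<integral>x. G x * f' x a \<partial>lborel) = - (\<integral>x. G' x a * f x \<partial>lborel)"
      using i by simp
    have I1: "integrable lborel (\<lambda>x. f x * g' x a)"
      by (intro Cc_integrable[OF K] Cc_mult[OF C1c_Cc[OF f]] C1c_deriv_continuous[OF g])
    have I2: "integrable lborel (\<lambda>x. f (x - h) * g' x a)"
    proof -
      have "continuous_on K (\<lambda>x. f (x - h))"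
        by (rule continuous_on_compose2[OF C1c_continuous[OF f, of UNIV]]) (auto intro!: continuous_intros)
      then show ?thesis
        by (rule Cc_integrable[OF K Cc_mult2[OF C1c_deriv_Cc[OF g]]])
    qed
    have I3: "integrable lborel (\<lambda>x. f x * g' (x + h) a)"
      using integrable_translate[OF I2, of h] by simp
    \<comment> \<open>Discrete integration by parts: the translation by \<open>h\<close> moves the
      difference from \<open>g'\<close> onto \<open>f\<close>, where it becomes a quotient in
      direction \<open>-b\<close>.\<close>
    have "(\<integral>x. f x * g' (x + h) a \<partial>lborel) = (\<integral>x. f (x - h) * g' x a \<partial>lborel)"
      using integral_translate[of "\<lambda>x. f (x - h) * g' x a" h] I2 by simp
    moreover have "(\<integral>x. G' x a * f x \<partial>lborel) = m * (\<integral>x. f x * g' (x + h) a - f x * g' x a \<partial>lborel)"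
      unfolding integral_mult_right_zero[symmetric]
      by (rule Bochner_Integration.integral_cong) (auto simp: G'_def algebra_simps)
    moreover have "(\<integral>x. (f (x - h) - f x) * m * g' x a \<partial>lborel) = m * (\<integral>x. f (x - h) * g' x a - f x * g' x a \<partial>lborel)"
      unfolding integral_mult_right_zero[symmetric]
      by (rule Bochner_Integration.integral_cong) (auto simp: algebra_simps)
    ultimately have 2: "(\<integral>x. G' x a * f x \<partial>lborel) = (\<integral>x. (f (x - h) - f x) * m * g' x a \<partial>lborel)"
      by (simp add: Bochner_Integration.integral_diff[OF I3 I1] Bochner_Integration.integral_diff[OF I2 I1])
    have "dq g b k = G"
      by (rule ext) (simp add: dq_def G_def h_def m_def algebra_simps)
    moreover have "dq f (-b) k = (\<lambda>x. (f (x - h) - f x) * m)"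
      by (rule ext) (simp add: dq_def h_def m_def)
    ultimately show ?thesis using 1 2 by (simp only:)
  qed
  have "(\<lambda>k. \<integral>x. dq g b k x * f' x a \<partial>lborel) \<longlonglongrightarrow> (\<integral>x. g' x b * f' x a \<partial>lborel)"
    by (rule dq_limit_integral[OF K g C1c_deriv_continuous[OF f]])
  moreover have "(\<lambda>k. - (\<integral>x. dq f (-b) k x * g' x a \<partial>lborel)) \<longlonglongrightarrow> - (\<integral>x. f' x (-b) * g' x a \<partial>lborel)"
    by (intro tendsto_minus dq_limit_integral[OF K f C1c_deriv_continuous[OF g]])
  ultimately have "(\<integral>x. g' x b * f' x a \<partial>lborel) = - (\<integral>x. f' x (-b) * g' x a \<partial>lborel)"
    unfolding step by (rule LIMSEQ_unique)
  moreover have "f' x (-b) = - f' x b" for x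
    using C1c_linear[OF f] by (simp add: linear_neg)
  ultimately have "(\<integral>x. g' x b * f' x a \<partial>lborel) = (\<integral>x. f' x b * g' x a \<partial>lborel)"
    by simp
  then show ?thesis by (simp only: mult.commute[of "g' _ b"])
qed

section \<open>Integration by parts along vector fields\<close>

definition C1field :: "'a::euclidean_space set \<Rightarrow> ('a \<Rightarrow> 'a) \<Rightarrow> ('a \<Rightarrow> 'a \<Rightarrow> 'a) \<Rightarrow> bool" where
  "C1field S X X' \<longleftrightarrow> (\<forall>x\<in>S. (X has_derivative X' x) (at x)) \<and> (\<forall>v. continuous_on S (\<lambda>x. X' x v))"

definition dvg :: "('a::euclidean_space \<Rightarrow> 'a \<Rightarrow> 'a) \<Rightarrow> 'a \<Rightarrow> real" where
  "dvg X' x = (\<Sum>b\<in>Basis. X' x b \<bullet> b)"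

lemma C1on_continuous: "C1on S f f' \<Longrightarrow> continuous_on S f"
  by (meson C1on_def has_derivative_continuous continuous_at_imp_continuous_on)

lemma C1field_component: "C1field S X X' \<Longrightarrow> C1on S (\<lambda>x. X x \<bullet> b) (\<lambda>x v. X' x v \<bullet> b)"
  by (auto simp: C1field_def C1on_def intro!: continuous_intros derivative_intros)

lemma C1on_mult:
  assumes "C1on S f f'" "C1on S g g'"
  shows "C1on S (\<lambda>x. f x * g x) (\<lambda>x v. f x * g' x v + f' x v * g x)"
  using assms C1on_continuous[OF assms(1)] C1on_continuous[OF assms(2)]
  by (auto simp: C1on_def intro!: has_derivative_mult continuous_intros)

lemma C1c_sum:
  assumes "finite I" "\<And>i. i \<in> I \<Longrightarrow> C1c K (f i) (f' i)"
  shows "C1c K (\<lambda>x. \<Sum>i\<in>I. f i x) (\<lambda>x v. \<Sum>i\<in>I. f' i x v)"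
  using assms by (auto simp: C1c_def intro!: has_derivative_sum continuous_intros)

lemma C1c_add:
  assumes "C1c K f f'" "C1c K g g'"
  shows "C1c K (\<lambda>x. f x + g x) (\<lambda>x v. f' x v + g' x v)"
  using assms by (auto simp: C1c_def intro!: has_derivative_add continuous_intros)

context
  fixes K S :: "'a::euclidean_space set"
  assumes K: "compact K" "K \<subseteq> S" "open S"
begin

lemma integral_deriv_field:
  assumes f: "C1c K f f'" and X: "C1field S X X'"
  shows "(\<integral>x. f' x (X x) + f x * dvg X' x \<partial>lborel) = 0"
proof -
  have *: "C1c K (\<lambda>x. (X x \<bullet> b) * f x) (\<lambda>x v. (X x \<bullet> b) * f' x v + (X' x v \<bullet> b) * f x)" for b
    by (rule C1c_mult_C1on[OF f C1field_component[OF X] K])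
  have "(\<integral>x. (\<Sum>b\<in>Basis. (X x \<bullet> b) * f' x b + (X' x b \<bullet> b) * f x) \<partial>lborel)
      = (\<Sum>b\<in>Basis. \<integral>x. (X x \<bullet> b) * f' x b + (X' x b \<bullet> b) * f x \<partial>lborel)"
    by (intro Bochner_Integration.integral_sum Cc_integrable[OF K(1) C1c_deriv_Cc[OF *]])
  also have "\<dots> = 0"
    by (intro sum.neutral ballI C1c_integral_deriv[OF K(1) *])
  finally show ?thesis
    by (simp add: sum.distrib C1c_deriv_basis[OF f, of _ "X _"] dvg_def sum_distrib_left mult.commute)
qed

text \<open>The unweighted exchange for \<open>m p\<close> and \<open>q\<close>; the product rule
  splits off the terms with \<open>m'\<close>.\<close>

lemma integral_swap_weighted:
  assumes p: "C1c K p p'" and q: "C1c K q q'" and m: "C1on S m m'"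
  shows "(\<integral>x. m x * (p' x i * q' x j - p' x j * q' x i) + p x * (m' x i * q' x j - m' x j * q' x i) \<partial>lborel) = 0"
    and "Cc K (\<lambda>x. m x * (p' x i * q' x j - p' x j * q' x i) + p x * (m' x i * q' x j - m' x j * q' x i))"
proof -
  note P = C1c_mult_C1on[OF p m K]
  have C: "Cc K (\<lambda>x. (m x * p' x i + m' x i * p x) * q' x j)" for i j
    by (rule Cc_mult[OF C1c_deriv_Cc[OF P] C1c_deriv_continuous[OF q]])
  have eq: "m x * (p' x i * q' x j - p' x j * q' x i) + p x * (m' x i * q' x j - m' x j * q' x i)
     = (m x * p' x i + m' x i * p x) * q' x j - (m x * p' x j + m' x j * p x) * q' x i" for x
    by (simp add: algebra_simps)
  show "(\<integral>x. m x * (p' x i * q' x j - p' x j * q' x i) + p x * (m' x i * q' x j - m' x j * q' x i) \<partial>lborel) = 0"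
    unfolding eq Bochner_Integration.integral_diff[OF Cc_integrable[OF K(1) C] Cc_integrable[OF K(1) C]]
    using integral_swap_directions[OF K(1) P q, of i j] by simp
  show "Cc K (\<lambda>x. m x * (p' x i * q' x j - p' x j * q' x i) + p x * (m' x i * q' x j - m' x j * q' x i))"
    unfolding eq using C[of i j] C[of j i] by (auto simp: Cc_def intro!: continuous_intros)
qed

text \<open>Formally \<open>X\<close> and \<open>Y\<close> are integrated off \<open>p\<close>, and
  the second derivatives of \<open>q\<close> cancel up to the commutator \<open>[X, Y] q\<close>,
  which is the pair of terms with \<open>Y'\<close> and \<open>X'\<close>.\<close>

lemma integral_swap_fields:
  assumes p: "C1c K p p'" and q: "C1c K q q'" and X: "C1field S X X'" and Y: "C1field S Y Y'"
  shows "(\<integral>x. p' x (X x) * q' x (Y x) - p' x (Y x) * q' x (X x)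
     + p x * (dvg X' x * q' x (Y x) - dvg Y' x * q' x (X x) + q' x (Y' x (X x)) - q' x (X' x (Y x))) \<partial>lborel) = 0"
    (is "(\<integral>x. ?F x \<partial>lborel) = 0")
proof -
  \<comment> \<open>The weighted exchange in the coordinate directions \<open>i\<close>,
    \<open>j\<close> with weight \<open>X_i Y_j\<close>; the sum over all pairs restores the
    fields.\<close>
  define G where "G i j x = (X x \<bullet> i * (Y x \<bullet> j)) * (p' x i * q' x j - p' x j * q' x i)
    + p x * ((X x \<bullet> i * (Y' x i \<bullet> j) + X' x i \<bullet> i * (Y x \<bullet> j)) * q' x j
           - (X x \<bullet> i * (Y' x j \<bullet> j) + X' x j \<bullet> i * (Y x \<bullet> j)) * q' x i)" for i j x
  note m = C1on_mult[OF C1field_component[OF X] C1field_component[OF Y]]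
  have G: "(\<integral>x. G i j x \<partial>lborel) = 0" "integrable lborel (G i j)" for i j
    using integral_swap_weighted[OF p q m, of i j i j] Cc_integrable[OF K(1)] unfolding G_def by blast+
  have "?F x = (\<Sum>i\<in>Basis. \<Sum>j\<in>Basis. G i j x)" for x
  proof (cases "x \<in> K")
    case True
    then have xS: "x \<in> S" using K by auto
    have lin: "linear (X' x)" "linear (Y' x)"
      using X Y xS by (auto simp: C1field_def intro: has_derivative_linear)
    have e: "l z = (\<Sum>i\<in>Basis. (z \<bullet> i) *\<^sub>R l i)" if "linear l" for l :: "'a \<Rightarrow> 'a" and z
      by (subst euclidean_representation[of z, symmetric], subst linear_sum[OF that])
        (simp add: linear_scale[OF that])
    have eq: "q' x (l z) = (\<Sum>i\<in>Basis. \<Sum>j\<in>Basis. (z \<bullet> i) * (l i \<bullet> j) * q' x j)"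
      if l: "linear l" for l :: "'a \<Rightarrow> 'a" and z
    proof -
      have "q' x (l z) = (\<Sum>i\<in>Basis. (z \<bullet> i) * q' x (l i))"
        unfolding e[OF l, of z]
        by (simp add: linear_sum[OF C1c_linear[OF q]] linear_scale[OF C1c_linear[OF q]])
      also have "\<dots> = (\<Sum>i\<in>Basis. \<Sum>j\<in>Basis. (z \<bullet> i) * (l i \<bullet> j) * q' x j)"
        by (simp add: C1c_deriv_basis[OF q, of x "l _"] sum_distrib_left mult.assoc)
      finally show ?thesis .
    qed
    note bp = C1c_deriv_basis[OF p, of x] and bq = C1c_deriv_basis[OF q, of x]
    have s: "(\<Sum>i\<in>Basis. a i) * (\<Sum>j\<in>Basis. b j) = (\<Sum>i\<in>Basis. \<Sum>j\<in>Basis. a i * b j)" for a b :: "'a \<Rightarrow> real"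
      by (rule sum_product)
    have 1: "p' x (X x) * q' x (Y x) = (\<Sum>i\<in>Basis. \<Sum>j\<in>Basis. X x \<bullet> i * (Y x \<bullet> j) * (p' x i * q' x j))"
      unfolding bp[of "X x"] bq[of "Y x"] s by (simp add: mult_ac)
    have 2: "p' x (Y x) * q' x (X x) = (\<Sum>i\<in>Basis. \<Sum>j\<in>Basis. X x \<bullet> i * (Y x \<bullet> j) * (p' x j * q' x i))"
      unfolding bp[of "Y x"] bq[of "X x"] mult.commute[of "sum _ _" "sum (\<lambda>b. X x \<bullet> b * _ b) _"] s by (simp add: mult_ac)
    have 3: "dvg X' x * q' x (Y x) = (\<Sum>i\<in>Basis. \<Sum>j\<in>Basis. X' x i \<bullet> i * (Y x \<bullet> j) * q' x j)"
      unfolding bq[of "Y x"] dvg_def s by (simp add: mult_ac)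
    have 4: "dvg Y' x * q' x (X x) = (\<Sum>i\<in>Basis. \<Sum>j\<in>Basis. X x \<bullet> i * (Y' x j \<bullet> j) * q' x i)"
      unfolding bq[of "X x"] dvg_def mult.commute[of "sum _ _" "sum (\<lambda>b. X x \<bullet> b * _ b) _"] s by (simp add: mult_ac)
    have 5: "q' x (X' x (Y x)) = (\<Sum>i\<in>Basis. \<Sum>j\<in>Basis. X' x j \<bullet> i * (Y x \<bullet> j) * q' x i)"
      unfolding eq[OF lin(1)] by (subst sum.swap) (simp add: mult_ac)
    show ?thesis
      unfolding 1 2 3 4 5 eq[OF lin(2)] G_def
      by (simp add: sum_subtractf sum.distrib sum_distrib_left algebra_simps)
  next
    case False
    then show ?thesis using p q by (simp add: C1c_def G_def)
  qed
  then have "(\<integral>x. ?F x \<partial>lborel) = (\<integral>x. (\<Sum>i\<in>Basis. \<Sum>j\<in>Basis. G i j x) \<partial>lborel)" by simp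
  also have "\<dots> = (\<Sum>i\<in>Basis. \<Sum>j\<in>Basis. \<integral>x. G i j x \<partial>lborel)"
    using G(2) by (simp add: Bochner_Integration.integral_sum Bochner_Integration.integrable_sum)
  finally show ?thesis using G(1) by simp
qed

end

section \<open>Functions of class C^2 and the symmetry of second derivatives\<close>

definition C2c :: "'a::euclidean_space set \<Rightarrow> ('a \<Rightarrow> real) \<Rightarrow> ('a \<Rightarrow> 'a \<Rightarrow> real) \<Rightarrow> ('a \<Rightarrow> 'a \<Rightarrow> 'a \<Rightarrow> real) \<Rightarrow> bool" where
  "C2c K f f' f'' \<longleftrightarrow> C1c K f f' \<and> (\<forall>v. C1c K (\<lambda>x. f' x v) (\<lambda>x. f'' x v))"

text \<open>The mean value theorem twice: along \<open>v\<close> for the increment of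
  \<open>f\<close> in direction \<open>w\<close>, then along \<open>w\<close> for the derivative so
  obtained.\<close>

lemma second_difference:
  fixes f :: "'a::euclidean_space \<Rightarrow> real"
  assumes f: "C2c K f f' f''" and h: "h > 0"
  shows "\<exists>s t. 0 < s \<and> s < h \<and> 0 < t \<and> t < h \<and>
     f (x + h *\<^sub>R v + h *\<^sub>R w) - f (x + h *\<^sub>R v) - f (x + h *\<^sub>R w) + f x = h * h * f'' (x + s *\<^sub>R v + t *\<^sub>R w) v w"
proof -
  define g where "g y = f (y + h *\<^sub>R w) - f y" for y
  have df: "(f has_derivative f' x) (at x)" for x using f by (simp add: C2c_def C1c_def)
  have d1: "((\<lambda>y. f (y + h *\<^sub>R w)) has_derivative f' (y + h *\<^sub>R w)) (at y)" for y
    by (rule has_derivative_compose[OF _ df, of "\<lambda>y. y + h *\<^sub>R w" "\<lambda>v. v" for x, simplified])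
       (auto intro!: derivative_eq_intros)
  have "(g has_derivative (\<lambda>v. f' (y + h *\<^sub>R w) v - f' y v)) (at y)" for y
    unfolding g_def by (intro has_derivative_diff d1 df)
  from line_mvt[OF this h, of x v] obtain s where s: "0 < s" "s < h"
    "g (x + h *\<^sub>R v) - g x = h * (f' (x + s *\<^sub>R v + h *\<^sub>R w) v - f' (x + s *\<^sub>R v) v)" by auto
  have "((\<lambda>y. f' y v) has_derivative f'' y v) (at y)" for y using f by (simp add: C2c_def C1c_def)
  from line_mvt[OF this h, of "x + s *\<^sub>R v" w] obtain t where t: "0 < t" "t < h"
    "f' (x + s *\<^sub>R v + h *\<^sub>R w) v - f' (x + s *\<^sub>R v) v = h * f'' (x + s *\<^sub>R v + t *\<^sub>R w) v w" by auto
  have "f (x + h *\<^sub>R v + h *\<^sub>R w) - f (x + h *\<^sub>R v) - f (x + h *\<^sub>R w) + f x = h * h * f'' (x + s *\<^sub>R v + t *\<^sub>R w) v w"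
    using s(3) unfolding t(3) g_def by simp
  with s t show ?thesis by blast
qed

lemma second_difference_limit:
  fixes f :: "'a::euclidean_space \<Rightarrow> real"
  assumes f: "C2c K f f' f''"
  shows "(\<lambda>k. (f (x + inverse (real (Suc k)) *\<^sub>R v + inverse (real (Suc k)) *\<^sub>R w) - f (x + inverse (real (Suc k)) *\<^sub>R v)
     - f (x + inverse (real (Suc k)) *\<^sub>R w) + f x) * (real (Suc k))\<^sup>2) \<longlonglongrightarrow> f'' x v w"
proof -
  have "\<forall>k. \<exists>s t. 0 < s \<and> s < inverse (real (Suc k)) \<and> 0 < t \<and> t < inverse (real (Suc k)) \<and>
    (f (x + inverse (real (Suc k)) *\<^sub>R v + inverse (real (Suc k)) *\<^sub>R w) - f (x + inverse (real (Suc k)) *\<^sub>R v)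
     - f (x + inverse (real (Suc k)) *\<^sub>R w) + f x) * (real (Suc k))\<^sup>2 = f'' (x + s *\<^sub>R v + t *\<^sub>R w) v w"
  proof
    fix k
    have "inverse (real (Suc k)) > 0" by simp
    from second_difference[OF f this, of x v w] obtain s t where
      st: "0 < s \<and> s < inverse (real (Suc k)) \<and> 0 < t \<and> t < inverse (real (Suc k))" and
      e: "f (x + inverse (real (Suc k)) *\<^sub>R v + inverse (real (Suc k)) *\<^sub>R w) - f (x + inverse (real (Suc k)) *\<^sub>R v)
     - f (x + inverse (real (Suc k)) *\<^sub>R w) + f x = inverse (real (Suc k)) * inverse (real (Suc k)) * f'' (x + s *\<^sub>R v + t *\<^sub>R w) v w"
      by blast
    have c: "inverse (real (Suc k)) * inverse (real (Suc k)) * z * (real (Suc k))\<^sup>2 = z" for z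
      by (simp add: power2_eq_square field_simps del: of_nat_Suc)
    show "\<exists>s t. 0 < s \<and> s < inverse (real (Suc k)) \<and> 0 < t \<and> t < inverse (real (Suc k)) \<and>
    (f (x + inverse (real (Suc k)) *\<^sub>R v + inverse (real (Suc k)) *\<^sub>R w) - f (x + inverse (real (Suc k)) *\<^sub>R v)
     - f (x + inverse (real (Suc k)) *\<^sub>R w) + f x) * (real (Suc k))\<^sup>2 = f'' (x + s *\<^sub>R v + t *\<^sub>R w) v w"
      unfolding e c using st by blast
  qed
  then obtain s t where st: "\<And>k. 0 < s k" "\<And>k. s k < inverse (real (Suc k))" "\<And>k. 0 < t k" "\<And>k. t k < inverse (real (Suc k))"
    and eq: "\<And>k. (f (x + inverse (real (Suc k)) *\<^sub>R v + inverse (real (Suc k)) *\<^sub>R w) - f (x + inverse (real (Suc k)) *\<^sub>R v)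
     - f (x + inverse (real (Suc k)) *\<^sub>R w) + f x) * (real (Suc k))\<^sup>2 = f'' (x + s k *\<^sub>R v + t k *\<^sub>R w) v w"
    by metis
  have lim: "r \<longlonglongrightarrow> 0" if "\<And>k. 0 < r k" "\<And>k. r k < inverse (real (Suc k))" for r :: "nat \<Rightarrow> real"
    by (rule tendsto_sandwich[OF _ _ tendsto_const LIMSEQ_inverse_real_of_nat])
      (auto intro!: always_eventually less_imp_le that simp del: of_nat_Suc)
  have "(\<lambda>k. x + s k *\<^sub>R v + t k *\<^sub>R w) \<longlonglongrightarrow> x + 0 *\<^sub>R v + 0 *\<^sub>R w"
    by (intro tendsto_intros lim st)
  then have l: "(\<lambda>k. x + s k *\<^sub>R v + t k *\<^sub>R w) \<longlonglongrightarrow> x" by simp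
  have "continuous_on UNIV (\<lambda>y. f'' y v w)" using f by (simp add: C2c_def C1c_def)
  then have "(\<lambda>k. f'' (x + s k *\<^sub>R v + t k *\<^sub>R w) v w) \<longlonglongrightarrow> f'' x v w"
    by (rule continuous_on_tendsto_compose[OF _ l]) auto
  then show ?thesis unfolding eq .
qed

text \<open>The second difference does not change when \<open>v\<close> and \<open>w\<close> are
  exchanged, so both orders of differentiation are limits of the same sequence.\<close>

lemma C2c_symmetric:
  assumes "C2c K f f' f''"
  shows "f'' x v w = f'' x w v"
proof (rule LIMSEQ_unique[OF second_difference_limit[OF assms, of x v w]])
  have 1: "x + h *\<^sub>R v + h *\<^sub>R w = x + h *\<^sub>R w + h *\<^sub>R v" for h by simp
  have 2: "a - f (x + h *\<^sub>R v) - f (x + h *\<^sub>R w) = a - f (x + h *\<^sub>R w) - f (x + h *\<^sub>R v)" for h a by simp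
  show "(\<lambda>k. (f (x + inverse (real (Suc k)) *\<^sub>R v + inverse (real (Suc k)) *\<^sub>R w) - f (x + inverse (real (Suc k)) *\<^sub>R v)
     - f (x + inverse (real (Suc k)) *\<^sub>R w) + f x) * (real (Suc k))\<^sup>2) \<longlonglongrightarrow> f'' x w v"
    using second_difference_limit[OF assms, of x w v] by (simp only: 1[of "inverse _"] 2[of _ "inverse _"])
qed

text \<open>The slot \<open>w\<close> is the later differentiation, so linearity there is immediate;
  in \<open>v\<close> it comes from symmetry.\<close>

lemma C2c_linear:
  assumes "C2c K f f' f''"
  shows "linear (f'' x v)" and "linear (\<lambda>v. f'' x v w)"
proof -
  show 1: "linear (f'' x v)" for v using assms by (auto simp: C2c_def intro: C1c_linear)
  show "linear (\<lambda>v. f'' x v w)" using 1[of w] by (simp add: C2c_symmetric[OF assms, of x _ w])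
qed

lemma C2c_deriv_field:
  assumes f: "C2c K f f' f''" and X: "C1field S X X'" and K: "compact K" "K \<subseteq> S" "open S"
  shows "C1c K (\<lambda>x. f' x (X x)) (\<lambda>x v. f'' x (X x) v + f' x (X' x v))"
proof -
  have c: "C1c K (\<lambda>x. f' x b) (\<lambda>x. f'' x b)" and c1: "C1c K f f'" for b using f by (auto simp: C2c_def)
  have *: "C1c K (\<lambda>x. \<Sum>b\<in>Basis. (X x \<bullet> b) * f' x b) (\<lambda>x v. \<Sum>b\<in>Basis. (X x \<bullet> b) * f'' x b v + (X' x v \<bullet> b) * f' x b)"
    by (intro C1c_sum C1c_mult_C1on[OF c C1field_component[OF X] K]) auto
  have "(\<Sum>b\<in>Basis. (X x \<bullet> b) * f'' x b v) = f'' x (X x) v" for x v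
  proof -
    have "f'' x (\<Sum>b\<in>Basis. (X x \<bullet> b) *\<^sub>R b) v = (\<Sum>b\<in>Basis. (X x \<bullet> b) * f'' x b v)"
      by (subst linear_sum[OF C2c_linear(2)[OF f]]) (simp add: linear_scale[OF C2c_linear(2)[OF f]])
    then show ?thesis by (simp add: euclidean_representation)
  qed
  with * show ?thesis
    by (simp add: sum.distrib flip: C1c_deriv_basis[OF c1])
qed

section \<open>Radial functions on the punctured ball\<close>

abbreviation pball :: "'a::euclidean_space set" where
  "pball \<equiv> ball 0 1 - {0}"

lemma open_pball: "open pball"
  by auto

lemma pball_norm: "x \<in> pball \<Longrightarrow> 0 < norm x" "x \<in> pball \<Longrightarrow> norm x < 1" "x \<in> pball \<Longrightarrow> (norm x)\<^sup>2 < 1"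
  by (auto simp: abs_square_less_1)

lemma conf_pos: "x \<in> pball \<Longrightarrow> conf x > 0"
  using pball_norm[of x] by (simp add: conf_def)

lemma hrho_pos: "x \<in> pball \<Longrightarrow> hrho x > 0"
  using pball_norm[of x] by (auto simp: hrho_def field_simps intro!: ln_gt_zero)

lemma exp_hrho: "x \<in> pball \<Longrightarrow> exp (hrho x) = (1 + norm x) / (1 - norm x)"
  using pball_norm(2)[of x] by (simp add: hrho_def exp_ln divide_pos_pos add_pos_nonneg)

lemma sinh_hrho:
  assumes "x \<in> pball"
  shows "sinh (hrho x) = conf x * norm x"
proof -
  define r where "r = norm x"
  have r: "0 < r" "r < 1" "1 - r\<^sup>2 \<noteq> 0" using pball_norm[OF assms] by (auto simp: r_def)
  show ?thesis unfolding sinh_def exp_minus exp_hrho[OF assms] conf_def r_def[symmetric]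
    using r by (simp add: divide_simps) (simp add: power2_eq_square algebra_simps)
qed

lemma cosh_hrho:
  assumes "x \<in> pball"
  shows "cosh (hrho x) = conf x * (1 + (norm x)\<^sup>2) / 2"
proof -
  define r where "r = norm x"
  have r: "0 < r" "r < 1" "1 - r\<^sup>2 \<noteq> 0" using pball_norm[OF assms] by (auto simp: r_def)
  show ?thesis unfolding cosh_def exp_minus exp_hrho[OF assms] conf_def r_def[symmetric]
    using r by (simp add: divide_simps) (simp add: power2_eq_square algebra_simps)
qed

text \<open>\<open>\<psi>'\<close> is the derivative of the radial function \<open>\<psi>\<close> with respect to the hyperbolic distance:
  \<open>conf x / norm x\<close> is the factor relating the gradient of the distance to \<open>x\<close>.\<close>
definition radw :: "('a::euclidean_space \<Rightarrow> real) \<Rightarrow> ('a \<Rightarrow> real) \<Rightarrow> bool" where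
  "radw \<psi> \<psi>' \<longleftrightarrow> (\<forall>x\<in>pball. (\<psi> has_derivative (\<lambda>v. \<psi>' x * (conf x / norm x) * (x \<bullet> v))) (at x)) \<and>
     continuous_on pball \<psi>'"

lemma radw_continuous: "radw \<psi> \<psi>' \<Longrightarrow> continuous_on pball \<psi>"
  by (meson radw_def has_derivative_continuous continuous_at_imp_continuous_on)

lemma radw_mult:
  assumes "radw f f'" "radw g g'"
  shows "radw (\<lambda>x. f x * g x) (\<lambda>x. f x * g' x + f' x * g x)"
  unfolding radw_def
proof (intro conjI ballI)
  fix x :: 'a assume x: "x \<in> pball"
  show "((\<lambda>x. f x * g x) has_derivative (\<lambda>v. (f x * g' x + f' x * g x) * (conf x / norm x) * (x \<bullet> v))) (at x)"
    by (rule has_derivative_eq_rhs[OF has_derivative_mult])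
      (use assms x in \<open>auto simp: radw_def algebra_simps add_divide_distrib\<close>)
next
  show "continuous_on pball (\<lambda>x. f x * g' x + f' x * g x)"
    using assms radw_continuous[OF assms(1)] radw_continuous[OF assms(2)]
    by (auto simp: radw_def intro!: continuous_intros)
qed

lemma radw_cong:
  assumes "radw f f'" "\<And>x. x \<in> pball \<Longrightarrow> f' x = g' x"
  shows "radw f g'"
proof -
  have "continuous_on pball f' \<longleftrightarrow> continuous_on pball g'"
    by (rule continuous_on_cong[OF refl assms(2)])
  with assms show ?thesis by (simp add: radw_def)
qed

lemma continuous_on_conf: "continuous_on pball conf"
  unfolding conf_def using pball_norm(3) by (intro continuous_intros) force

lemma radw_hrho: "radw hrho (\<lambda>_. 1)"
  unfolding radw_def
proof (intro conjI ballI)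
  fix x :: 'a assume x: "x \<in> pball"
  have r: "0 < norm x" "norm x < 1" "x \<noteq> 0" using pball_norm[OF x] x by auto
  have "((\<lambda>t. ln ((1 + t) / (1 - t))) has_real_derivative 2 / (1 - t\<^sup>2)) (at t)" if t: "0 < t" "t < 1" for t :: real
  proof -
    have "1 - t\<^sup>2 \<noteq> 0" "t\<^sup>2 \<noteq> 1" using t by (auto simp: power2_eq_1_iff)
    then show ?thesis
      using t by (auto intro!: derivative_eq_intros simp: divide_simps)
        (simp add: power2_eq_square algebra_simps)
  qed
  then have "((\<lambda>t. ln ((1 + t) / (1 - t))) has_real_derivative conf x) (at (norm x))"
    using r by (simp add: conf_def)
  then have "((\<lambda>t. ln ((1 + t) / (1 - t))) has_derivative (\<lambda>s. conf x * s)) (at (norm x))"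
    by (simp add: has_field_derivative_def)
  from has_derivative_compose[OF has_derivative_norm[OF r(3)] this]
  have "(hrho has_derivative (\<lambda>v. conf x * (v \<bullet> sgn x))) (at x)"
    by (simp add: hrho_def[abs_def])
  then show "(hrho has_derivative (\<lambda>v. 1 * (conf x / norm x) * (x \<bullet> v))) (at x)"
    by (simp add: sgn_div_norm inner_commute divide_inverse mult_ac)
qed simp

lemma continuous_on_hrho: "continuous_on pball hrho"
  by (rule radw_continuous[OF radw_hrho])

lemma radw_compose:
  assumes "\<And>t. t > 0 \<Longrightarrow> (h has_real_derivative h' t) (at t)" "continuous_on {0<..} h'"
  shows "radw (\<lambda>x. h (hrho x)) (\<lambda>x. h' (hrho x))"
  unfolding radw_def
proof (intro conjI ballI)
  fix x :: 'a assume x: "x \<in> pball"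
  have "(h has_derivative (\<lambda>s. h' (hrho x) * s)) (at (hrho x))"
    using assms(1)[OF hrho_pos[OF x]] by (simp add: has_field_derivative_def)
  moreover have "(hrho has_derivative (\<lambda>v. (conf x / norm x) * (x \<bullet> v))) (at x)"
    using radw_hrho x by (auto simp: radw_def)
  ultimately have "((\<lambda>x. h (hrho x)) has_derivative (\<lambda>v. h' (hrho x) * ((conf x / norm x) * (x \<bullet> v)))) (at x)"
    by (rule has_derivative_compose[rotated])
  then show "((\<lambda>x. h (hrho x)) has_derivative (\<lambda>v. h' (hrho x) * (conf x / norm x) * (x \<bullet> v))) (at x)"
    by (simp add: mult.assoc)
next
  show "continuous_on pball (\<lambda>x::'a. h' (hrho x))"
    by (rule continuous_on_compose2[OF assms(2) continuous_on_hrho]) (use hrho_pos in blast)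
qed

lemma radw_conf_power: "radw (\<lambda>x. conf x ^ k) (\<lambda>x. real k * conf x ^ k * norm x)"
  unfolding radw_def
proof (intro conjI ballI)
  fix x :: 'a assume x: "x \<in> pball"
  have ne: "1 - x \<bullet> x \<noteq> 0" "norm x > 0" using pball_norm[OF x] by (auto simp: power2_norm_eq_inner)
  have d: "(conf has_derivative (\<lambda>v. (conf x)\<^sup>2 * (x \<bullet> v))) (at x)"
    unfolding conf_def[abs_def] power2_norm_eq_inner
    by (rule has_derivative_eq_rhs, (rule derivative_intros | rule ne)+)
      (auto simp: fun_eq_iff power2_eq_square field_simps inner_commute ne)
  have "real k * conf x ^ (k - 1) * (conf x)\<^sup>2 = real k * conf x ^ k * conf x"
    by (cases k) (auto simp: power2_eq_square)
  then have "real k * conf x ^ (k - 1) * ((conf x)\<^sup>2 * z) = real k * conf x ^ k * conf x * z" for z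
    by (metis mult.assoc)
  then show "((\<lambda>x. conf x ^ k) has_derivative (\<lambda>v. real k * conf x ^ k * norm x * (conf x / norm x) * (x \<bullet> v))) (at x)"
    using ne by (intro has_derivative_eq_rhs[OF has_derivative_power[OF d]]) (auto simp: fun_eq_iff mult_ac)
qed (intro continuous_intros continuous_on_conf)

lemma radw_inverse_norm: "radw (\<lambda>x. inverse (norm x)) (\<lambda>x. - inverse (conf x * (norm x)\<^sup>2))"
  unfolding radw_def
proof (intro conjI ballI)
  fix x :: 'a assume x: "x \<in> pball"
  have ne: "x \<noteq> 0" "norm x \<noteq> 0" "conf x \<noteq> 0" using x conf_pos[OF x] by auto
  show "((\<lambda>x. inverse (norm x)) has_derivative (\<lambda>v. - inverse (conf x * (norm x)\<^sup>2) * (conf x / norm x) * (x \<bullet> v))) (at x)"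
    by (rule has_derivative_eq_rhs[OF Deriv.has_derivative_inverse[OF ne(2) has_derivative_norm[OF ne(1)]]])
      (use ne in \<open>auto simp: fun_eq_iff sgn_div_norm inner_commute divide_simps power2_eq_square\<close>)
next
  show "continuous_on pball (\<lambda>x::'a. - inverse (conf x * (norm x)\<^sup>2))"
    using conf_pos by (intro continuous_intros continuous_on_conf) force
qed

text \<open>The integral is over the whole space, but it is applied to integrands supported in a
  compact part of the punctured ball, where \<open>conf\<close> is positive and continuous.\<close>

definition hint :: "('a::euclidean_space \<Rightarrow> real) \<Rightarrow> real" where
  "hint F = (\<integral>x. F x * conf x ^ DIM('a) \<partial>lborel)"

definition coth_rho :: "'a::euclidean_space \<Rightarrow> real" where
  "coth_rho x = cosh (hrho x) / sinh (hrho x)"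

text \<open>These are the generators of rotations: the field is tangent to spheres, annihilates
  radial functions and is divergence-free.\<close>

definition skew :: "('a::euclidean_space \<Rightarrow> 'a) \<Rightarrow> bool" where
  "skew A \<longleftrightarrow> linear A \<and> (\<forall>x. x \<bullet> A x = 0)"

section \<open>Euclidean divergence of radial and rotational fields\<close>

lemma radw_field:
  assumes "radw \<psi> \<psi>'" "linear A"
  shows "C1field pball (\<lambda>x. \<psi> x *\<^sub>R A x) (\<lambda>x v. \<psi> x *\<^sub>R A v + (\<psi>' x * (conf x / norm x) * (x \<bullet> v)) *\<^sub>R A x)"
proof -
  have A: "(A has_derivative A) F" "continuous_on U A" for F U
    using assms(2) by (auto intro: bounded_linear_imp_has_derivative linear_continuous_on simp: linear_linear)
  show ?thesis
    using assms(1) radw_continuous[OF assms(1)] A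
    by (auto simp: radw_def C1field_def intro!: has_derivative_scaleR continuous_intros continuous_on_conf)
qed

lemma dvg_radw_ident:
  "dvg (\<lambda>x v. \<psi> x *\<^sub>R v + (\<psi>' x * (conf x / norm x) * (x \<bullet> v)) *\<^sub>R x) x
    = real DIM('a) * \<psi> x + \<psi>' x * (conf x * norm x)" for x :: "'a::euclidean_space"
proof -
  have "(\<Sum>b\<in>Basis. (x \<bullet> b) * (x \<bullet> b)) = (norm x)\<^sup>2"
    by (simp add: euclidean_inner[of x x] power2_norm_eq_inner flip: power2_eq_square)
  then have "(\<Sum>b\<in>Basis. \<psi>' x * (conf x / norm x) * (x \<bullet> b) * (x \<bullet> b)) = \<psi>' x * (conf x / norm x) * (norm x)\<^sup>2"
    by (simp only: mult.assoc flip: sum_distrib_left)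
  then show ?thesis
    by (simp add: dvg_def inner_add_left sum.distrib power2_eq_square)
qed

lemma dvg_radw_skew:
  assumes "skew A"
  shows "dvg (\<lambda>x v. \<psi> x *\<^sub>R A v + (\<psi>' x * (conf x / norm x) * (x \<bullet> v)) *\<^sub>R A x) x = 0"
proof -
  have "(\<Sum>b\<in>Basis. (x \<bullet> b) * (A x \<bullet> b)) = 0"
    using assms by (simp add: skew_def flip: euclidean_inner)
  then have "(\<Sum>b\<in>Basis. \<psi>' x * (conf x / norm x) * (x \<bullet> b) * (A x \<bullet> b)) = 0"
    by (simp only: mult.assoc flip: sum_distrib_left)
  moreover have "A b \<bullet> b = 0" for b using assms by (simp add: skew_def inner_commute)
  ultimately show ?thesis
    by (simp add: dvg_def inner_add_left sum.distrib)
qed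

section \<open>Integration against the hyperbolic volume\<close>

lemma Cc_add: "Cc K f \<Longrightarrow> Cc K g \<Longrightarrow> Cc K (\<lambda>x. f x + g x)"
  by (auto simp: Cc_def intro!: continuous_intros)

lemma Cc_diff: "Cc K f \<Longrightarrow> Cc K g \<Longrightarrow> Cc K (\<lambda>x. f x - g x)"
  by (auto simp: Cc_def intro!: continuous_intros)

lemma Cc_sum: "(\<And>i. i \<in> I \<Longrightarrow> Cc K (f i)) \<Longrightarrow> Cc K (\<lambda>x. \<Sum>i\<in>I. f i x)"
  by (auto simp: Cc_def intro!: continuous_intros)

lemma Cc_cmult: "Cc K f \<Longrightarrow> Cc K (\<lambda>x. c * f x)"
  by (auto simp: Cc_def intro!: continuous_intros)

lemma Cc_power2: "Cc K f \<Longrightarrow> Cc K (\<lambda>x. (f x)\<^sup>2)"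
  by (auto simp: Cc_def intro!: continuous_intros)

lemma radw_coth: "radw coth_rho (\<lambda>x. - (1 / (sinh (hrho x))\<^sup>2))"
proof -
  have "radw (\<lambda>x::'a. (\<lambda>t. cosh t / sinh t) (hrho x)) (\<lambda>x. (\<lambda>t. - (1 / (sinh t)\<^sup>2)) (hrho x))"
  proof (rule radw_compose)
    show "((\<lambda>t. cosh t / sinh t) has_real_derivative - (1 / (sinh t)\<^sup>2)) (at t)" if "t > 0" for t :: real
      using that cosh_square_eq[of t]
      by (auto intro!: derivative_eq_intros simp: power2_eq_square divide_simps)
    show "continuous_on {0<..} (\<lambda>t::real. - (1 / (sinh t)\<^sup>2))"
      by (intro continuous_intros) auto
  qed
  then show ?thesis by (simp add: coth_rho_def[abs_def])
qed

lemma radw_inverse_sinh: "radw (\<lambda>x. 1 / sinh (hrho x)) (\<lambda>x. - (coth_rho x / sinh (hrho x)))"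
proof -
  have "radw (\<lambda>x::'a. (\<lambda>t. 1 / sinh t) (hrho x)) (\<lambda>x. (\<lambda>t. - (cosh t / sinh t / sinh t)) (hrho x))"
  proof (rule radw_compose)
    show "((\<lambda>t. 1 / sinh t) has_real_derivative - (cosh t / sinh t / sinh t)) (at t)" if "t > 0" for t :: real
      using that by (auto intro!: derivative_eq_intros simp: divide_simps)
    show "continuous_on {0<..} (\<lambda>t::real. - (cosh t / sinh t / sinh t))"
      by (intro continuous_intros) auto
  qed
  then show ?thesis by (simp add: coth_rho_def)
qed

lemmas continuous_on_coth_rho = radw_continuous[OF radw_coth]
  and continuous_on_inverse_sinh = radw_continuous[OF radw_inverse_sinh]

lemma radw_cmult: "radw f f' \<Longrightarrow> radw (\<lambda>x. c * f x) (\<lambda>x. c * f' x)"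
  using radw_mult[of "\<lambda>_. c" "\<lambda>_. 0" f f'] by (simp add: radw_def)

text \<open>The radial derivative conjugated by \<open>(sinh \<rho>)\<^sup>c\<close>, \<open>c = (n - 1) / 2\<close>; \<open>sinh (hrho x) = conf x * norm x\<close>
  turns \<open>f' x x\<close> into the derivative along the hyperbolic unit radial field.\<close>
definition Rt :: "('a::euclidean_space \<Rightarrow> real) \<Rightarrow> ('a \<Rightarrow> 'a \<Rightarrow> real) \<Rightarrow> 'a \<Rightarrow> real" where
  "Rt f f' x = f' x x / sinh (hrho x) + (real DIM('a) - 1) / 2 * coth_rho x * f x"

text \<open>Multiplied by \<open>(n - 1) * conf x ^ (n - 1)\<close>, the left side is the Euclidean
  divergence of \<open>conf x ^ n\<close> times the hyperbolic unit radial field. The identity thus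
  says that geodesic spheres expand at the rate \<open>(n - 1) coth \<rho>\<close>.\<close>

lemma conf_coth_identity:
  assumes "x \<in> pball"
  shows "inverse (norm x) + conf x * norm x = conf x * coth_rho x"
proof -
  define r where "r = norm x"
  have r: "0 < r" "r < 1" "1 - r\<^sup>2 \<noteq> 0" using pball_norm[OF assms] by (auto simp: r_def)
  show ?thesis
    unfolding coth_rho_def sinh_hrho[OF assms] cosh_hrho[OF assms] conf_def r_def[symmetric]
    using r by (simp add: divide_simps) (simp add: power2_eq_square algebra_simps)
qed

locale compact_pball =
  fixes K :: "'a::euclidean_space set"
  assumes K: "compact K" "K \<subseteq> pball"
begin

lemma hint_integrable: "Cc K F \<Longrightarrow> integrable lborel (\<lambda>x. F x * conf x ^ DIM('a))"
  using K continuous_on_subset[OF continuous_on_conf K(2)]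
  by (intro Cc_integrable[OF K(1)] Cc_mult continuous_intros)

lemma hint_add: "Cc K F \<Longrightarrow> Cc K G \<Longrightarrow> hint (\<lambda>x. F x + G x) = hint F + hint G"
  unfolding hint_def using hint_integrable[of F] hint_integrable[of G] by (simp add: distrib_right)

lemma hint_diff: "Cc K F \<Longrightarrow> Cc K G \<Longrightarrow> hint (\<lambda>x. F x - G x) = hint F - hint G"
  unfolding hint_def using hint_integrable[of F] hint_integrable[of G] by (simp add: left_diff_distrib)

lemma hint_sum: "(\<And>i. i \<in> I \<Longrightarrow> Cc K (F i)) \<Longrightarrow> hint (\<lambda>x. \<Sum>i\<in>I. F i x) = (\<Sum>i\<in>I. hint (F i))"
  unfolding hint_def sum_distrib_right
  by (intro Bochner_Integration.integral_sum hint_integrable)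

lemma hint_cmult: "hint (\<lambda>x. c * F x) = c * hint F"
  unfolding hint_def by (simp add: mult.assoc)

lemma hint_mono:
  assumes "Cc K F" "Cc K G" "\<And>x. x \<in> K \<Longrightarrow> F x \<le> G x"
  shows "hint F \<le> hint G"
  unfolding hint_def
proof (rule integral_mono[OF hint_integrable[OF assms(1)] hint_integrable[OF assms(2)]])
  show "F x * conf x ^ DIM('a) \<le> G x * conf x ^ DIM('a)" for x
  proof (cases "x \<in> K")
    case True
    then have "conf x > 0" using K conf_pos by blast
    then show ?thesis using assms(3)[OF True] by (simp add: mult_right_mono)
  qed (use assms in \<open>simp add: Cc_def\<close>)
qed

lemma radw_continuous_K: "radw \<psi> \<psi>' \<Longrightarrow> continuous_on K \<psi>" "radw \<psi> \<psi>' \<Longrightarrow> continuous_on K \<psi>'"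
  using K(2) continuous_on_subset radw_continuous unfolding radw_def by blast+

lemma Rt_Cc:
  assumes "C1c K f f'"
  shows "Cc K (Rt f f')"
proof -
  have "Cc K (\<lambda>x. f' x x * (1 / sinh (hrho x)) + (real DIM('a) - 1) / 2 * (coth_rho x * f x))"
    by (intro Cc_add Cc_cmult Cc_mult[OF C1c_deriv_field_Cc[OF assms]] Cc_mult2[OF C1c_Cc[OF assms]]
      continuous_on_subset[OF continuous_on_coth_rho K(2)]
      continuous_on_subset[OF continuous_on_inverse_sinh K(2)] continuous_on_id)
  then show ?thesis by (simp add: Rt_def[abs_def] mult.assoc)
qed

lemma skew_Cc: "C1c K f f' \<Longrightarrow> skew A \<Longrightarrow> Cc K (\<lambda>x. f' x (A x))"
  by (intro C1c_deriv_field_Cc) (auto simp: skew_def linear_continuous_on linear_linear)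

text \<open>The first claim is the divergence theorem for \<open>\<psi> f\<close> times the unit
  radial field. The second exchanges this field with a rotation field: linear maps commute with
  dilations and the coefficients are radial, so the commutator vanishes and only the divergence of
  the radial field remains.\<close>

lemma hint_radial_divergence:
  assumes f: "C1c K f f'" and \<psi>: "radw \<psi> \<psi>'"
  shows "hint (\<lambda>x. \<psi> x * (f' x x / sinh (hrho x) + (real DIM('a) - 1) * coth_rho x * f x) + \<psi>' x * f x) = 0"
    and "\<lbrakk>C1c K g g'; skew A\<rbrakk> \<Longrightarrow> hint (\<lambda>x. \<psi> x * ((f' x x * g' x (A x) - f' x (A x) * g' x x) / sinh (hrho x))
       + f x * ((\<psi>' x + (real DIM('a) - 1) * coth_rho x * \<psi> x) * g' x (A x))) = 0"
proof -
  let ?n = "DIM('a)"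
  \<comment> \<open>\<open>J x *\<^sub>R x\<close> is the density \<open>conf x ^ n\<close> times
    the unit radial field \<open>x / (conf x * norm x)\<close>.\<close>
  define J :: "'a \<Rightarrow> real" where "J x = conf x ^ (?n - 1) * inverse (norm x)" for x
  define J' :: "'a \<Rightarrow> real" where "J' x = conf x ^ (?n - 1) * - inverse (conf x * (norm x)\<^sup>2)
     + real (?n - 1) * conf x ^ (?n - 1) * norm x * inverse (norm x)" for x
  have J: "radw J J'"
    unfolding J_def[abs_def] J'_def[abs_def] by (rule radw_mult[OF radw_conf_power radw_inverse_norm])
  note P = radw_mult[OF \<psi> J]
  have n1: "real (?n - 1) = real ?n - 1" by (simp add: of_nat_diff Suc_leI)
  have pow: "conf x * conf x ^ (?n - 1) = conf x ^ ?n" for x :: 'a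
    by (metis DIM_positive power_eq_if neq0_conv)
  have *: "J x = conf x ^ ?n / sinh (hrho x)"
    "real ?n * (\<psi> x * J x) + (\<psi> x * J' x + \<psi>' x * J x) * (conf x * norm x)
      = (\<psi>' x + (real ?n - 1) * coth_rho x * \<psi> x) * conf x ^ ?n" if "x \<in> K" for x
  proof -
    have x: "x \<in> pball" using that K by auto
    have pos: "conf x > 0" "norm x > 0" using conf_pos[OF x] pball_norm[OF x] by auto
    show "J x = conf x ^ ?n / sinh (hrho x)"
      unfolding sinh_hrho[OF x] J_def pow[symmetric] using pos by (simp add: field_simps)
    have 1: "J x * (conf x * norm x) = conf x ^ ?n"
      unfolding J_def pow[symmetric] using pos by simp
    have "real ?n * J x + J' x * (conf x * norm x)
       = conf x ^ (?n - 1) * (real ?n - 1) * (inverse (norm x) + conf x * norm x)"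
      unfolding J_def J'_def n1 using pos by (simp add: field_simps power2_eq_square)
    also have "\<dots> = (real ?n - 1) * coth_rho x * conf x ^ ?n"
      unfolding conf_coth_identity[OF x] pow[symmetric] by simp
    finally have 2: "real ?n * J x + J' x * (conf x * norm x) = (real ?n - 1) * coth_rho x * conf x ^ ?n" .
    have "real ?n * (\<psi> x * J x) + (\<psi> x * J' x + \<psi>' x * J x) * (conf x * norm x)
       = \<psi> x * (real ?n * J x + J' x * (conf x * norm x)) + \<psi>' x * (J x * (conf x * norm x))"
      by (simp add: algebra_simps)
    then show "real ?n * (\<psi> x * J x) + (\<psi> x * J' x + \<psi>' x * J x) * (conf x * norm x)
      = (\<psi>' x + (real ?n - 1) * coth_rho x * \<psi> x) * conf x ^ ?n"
      unfolding 1 2 by (simp add: algebra_simps)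
  qed
  note X = radw_field[OF P linear_id, unfolded id_apply]
  have "(\<psi> x * (f' x x / sinh (hrho x) + (real ?n - 1) * coth_rho x * f x) + \<psi>' x * f x) * conf x ^ ?n
     = f' x ((\<psi> x * J x) *\<^sub>R x) + f x * dvg (\<lambda>x v. (\<psi> x * J x) *\<^sub>R v +
            ((\<psi> x * J' x + \<psi>' x * J x) * (conf x / norm x) * (x \<bullet> v)) *\<^sub>R x) x" for x
  proof (cases "x \<in> K")
    case True
    show ?thesis
      unfolding dvg_radw_ident *(2)[OF True] unfolding linear_scale[OF C1c_linear[OF f]] *(1)[OF True]
      by (simp add: algebra_simps)
  next
    case False
    then show ?thesis using f by (simp add: C1c_def)
  qed
  then show "hint (\<lambda>x. \<psi> x * (f' x x / sinh (hrho x) + (real DIM('a) - 1) * coth_rho x * f x) + \<psi>' x * f x) = 0"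
    unfolding hint_def using integral_deriv_field[OF K open_pball f X] by simp
  assume g: "C1c K g g'" and A: "skew A"
  have Al: "linear A" and Ax: "x \<bullet> A x = 0" for x using A by (auto simp: skew_def)
  have one: "radw (\<lambda>_. 1) (\<lambda>_::'a. 0)" by (simp add: radw_def)
  note Y = radw_field[OF one Al]
  have "(\<psi> x * ((f' x x * g' x (A x) - f' x (A x) * g' x x) / sinh (hrho x))
       + f x * ((\<psi>' x + (real ?n - 1) * coth_rho x * \<psi> x) * g' x (A x))) * conf x ^ ?n
   = f' x ((\<psi> x * J x) *\<^sub>R x) * g' x (1 *\<^sub>R A x) - f' x (1 *\<^sub>R A x) * g' x ((\<psi> x * J x) *\<^sub>R x) +
            f x * (dvg (\<lambda>x v. (\<psi> x * J x) *\<^sub>R v + ((\<psi> x * J' x + \<psi>' x * J x) * (conf x / norm x) * (x \<bullet> v)) *\<^sub>R x) x * g' x (1 *\<^sub>R A x)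
              - dvg (\<lambda>x v. 1 *\<^sub>R A v + (0 * (conf x / norm x) * (x \<bullet> v)) *\<^sub>R A x) x * g' x ((\<psi> x * J x) *\<^sub>R x)
              + g' x (1 *\<^sub>R A ((\<psi> x * J x) *\<^sub>R x) + (0 * (conf x / norm x) * (x \<bullet> (\<psi> x * J x) *\<^sub>R x)) *\<^sub>R A x)
              - g' x ((\<psi> x * J x) *\<^sub>R 1 *\<^sub>R A x + ((\<psi> x * J' x + \<psi>' x * J x) * (conf x / norm x) * (x \<bullet> 1 *\<^sub>R A x)) *\<^sub>R x))" for x
  proof (cases "x \<in> K")
    case True
    show ?thesis
      unfolding dvg_radw_ident *(2)[OF True]
      unfolding linear_scale[OF C1c_linear[OF f]] linear_scale[OF C1c_linear[OF g]]
        *(1)[OF True] linear_scale[OF Al] dvg_radw_skew[OF A, of "\<lambda>_. 1" "\<lambda>_. 0"]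
      by (simp add: algebra_simps Ax diff_divide_distrib linear_scale[OF C1c_linear[OF g]])
  next
    case False
    then show ?thesis using f by (simp add: C1c_def)
  qed
  then show "hint (\<lambda>x. \<psi> x * ((f' x x * g' x (A x) - f' x (A x) * g' x x) / sinh (hrho x))
       + f x * ((\<psi>' x + (real DIM('a) - 1) * coth_rho x * \<psi> x) * g' x (A x))) = 0"
    unfolding hint_def using integral_swap_fields[OF K open_pball f g X Y] by simp
qed

lemma hint_skew_divergence:
  assumes f: "C1c K f f'" and \<psi>: "radw \<psi> \<psi>'" and A: "skew A"
  shows "hint (\<lambda>x. \<psi> x * f' x (A x)) = 0"
proof -
  have Al: "linear A" using A by (auto simp: skew_def)
  note X = radw_field[OF radw_mult[OF \<psi> radw_conf_power[of "DIM('a)"]] Al]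
  show ?thesis
    using integral_deriv_field[OF K open_pball f X]
    unfolding dvg_radw_skew[OF A] hint_def linear_scale[OF C1c_linear[OF f]] by (simp add: mult_ac)
qed

text \<open>The radial weight and the volume density are invisible to rotations, so the only
  correction is the commutator of \<open>A\<close> and \<open>B\<close>.\<close>

lemma hint_swap_skew:
  assumes f: "C1c K f f'" and g: "C1c K g g'" and \<psi>: "radw \<psi> \<psi>'" and A: "skew A" and B: "skew B"
  shows "hint (\<lambda>x. \<psi> x * (f' x (A x) * g' x (B x) - f' x (B x) * g' x (A x) + f x * (g' x (B (A x)) - g' x (A (B x))))) = 0"
proof -
  have l: "linear A" "linear B" and Bx: "x \<bullet> B x = 0" for x using A B by (auto simp: skew_def)
  have one: "radw (\<lambda>_. 1) (\<lambda>_::'a. 0)" by (simp add: radw_def)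
  note X = radw_field[OF radw_mult[OF \<psi> radw_conf_power[of "DIM('a)"]] l(1)]
  note Y = radw_field[OF one l(2)]
  show ?thesis
    using integral_swap_fields[OF K open_pball f g X Y]
    unfolding dvg_radw_skew[OF A] dvg_radw_skew[OF B, of "\<lambda>_. 1" "\<lambda>_. 0"] hint_def
      linear_scale[OF C1c_linear[OF f]] linear_scale[OF C1c_linear[OF g]] linear_scale[OF l(2)]
    by (simp add: Bx algebra_simps linear_scale[OF C1c_linear[OF g]])
qed

end

section \<open>Hardy inequalities\<close>

lemma Cc_prod: "Cc K f \<Longrightarrow> Cc K g \<Longrightarrow> Cc K (\<lambda>x. f x * g x)"
  by (simp add: Cc_def continuous_on_mult)

definition phi :: "'a::euclidean_space \<Rightarrow> real" where
  "phi x = 1 / (sinh (hrho x))\<^sup>2"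

lemma phi_nonneg: "phi x \<ge> 0"
  by (simp add: phi_def)

lemma sinh_hrho_pos: "x \<in> pball \<Longrightarrow> sinh (hrho x) > 0"
  using hrho_pos[of x] by simp

lemma coth_rho_square: "x \<in> pball \<Longrightarrow> (coth_rho x)\<^sup>2 = 1 + phi x"
  using sinh_hrho_pos[of x] cosh_square_eq[of "hrho x"]
  by (simp add: coth_rho_def phi_def power_divide field_simps)

lemma radw_phi: "radw phi (\<lambda>x. - 2 * (coth_rho x * phi x))"
  by (rule radw_cong[OF radw_mult[OF radw_inverse_sinh radw_inverse_sinh], simplified,
        folded power2_eq_square, folded phi_def[abs_def]])
    (simp add: phi_def power2_eq_square)

text \<open>\<open>coth\<^sup>2 = 1 + phi\<close> eliminates \<open>coth\<close>. The constants 4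
  and 6 are the source of all negative contributions later: moving \<open>T\<close> twice produces
  the second derivative of a weight.\<close>

lemma radw_phi': "radw (\<lambda>x. - 2 * (coth_rho x * phi x)) (\<lambda>x. 4 * phi x + 6 * (phi x)\<^sup>2)"
proof (rule radw_cong[OF radw_cmult[OF radw_mult[OF radw_coth radw_phi]]])
  fix x :: 'a assume "x \<in> pball"
  have "- 2 * (coth_rho x * (- 2 * (coth_rho x * phi x)) + - (1 / (sinh (hrho x))\<^sup>2) * phi x)
     = 4 * (coth_rho x)\<^sup>2 * phi x + 2 * phi x * phi x"
    by (simp add: phi_def power2_eq_square)
  then show "- 2 * (coth_rho x * (- 2 * (coth_rho x * phi x)) + - (1 / (sinh (hrho x))\<^sup>2) * phi x) = 4 * phi x + 6 * (phi x)\<^sup>2"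
    unfolding coth_rho_square[OF \<open>x \<in> pball\<close>] by (simp add: power2_eq_square algebra_simps)
qed

lemma radw_inverse_hrho_power: "radw (\<lambda>x. 1 / hrho x ^ k) (\<lambda>x. - (real k / hrho x ^ Suc k))"
proof -
  have "radw (\<lambda>x::'a. (\<lambda>t. 1 / t ^ k) (hrho x)) (\<lambda>x. (\<lambda>t. - (real k / t ^ Suc k)) (hrho x))"
  proof (rule radw_compose)
    show "((\<lambda>t. 1 / t ^ k) has_real_derivative - (real k / t ^ Suc k)) (at t)" if "t > 0" for t :: real
    proof (cases k)
      case (Suc m)
      have "((\<lambda>t. inverse (t ^ Suc m)) has_real_derivative - (real (Suc m) / t ^ Suc (Suc m))) (at t)"
        by (rule DERIV_cong[OF DERIV_inverse_fun[OF DERIV_pow]]) (use that in \<open>auto simp: field_simps\<close>)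
      then show ?thesis by (simp only: Suc inverse_eq_divide)
    qed simp
    show "continuous_on {0<..} (\<lambda>t::real. - (real k / t ^ Suc k))"
      by (intro continuous_intros) auto
  qed
  then show ?thesis by simp
qed

lemma radw_const: "radw (\<lambda>_. c) (\<lambda>_. 0)"
  by (simp add: radw_def)

lemma radw_add:
  assumes "radw f f'" "radw g g'"
  shows "radw (\<lambda>x. f x + g x) (\<lambda>x. f' x + g' x)"
  using assms unfolding radw_def
  by (auto intro!: has_derivative_eq_rhs[OF has_derivative_add] continuous_intros simp: algebra_simps add_divide_distrib)

context compact_pball
begin

lemma hint_nonneg: "Cc K F \<Longrightarrow> (\<And>x. x \<in> K \<Longrightarrow> 0 \<le> F x) \<Longrightarrow> 0 \<le> hint F"
  using hint_mono[of "\<lambda>_. 0" F] by (simp add: Cc_def hint_def)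

lemma continuous_K: "continuous_on pball f \<Longrightarrow> continuous_on K f"
  using K continuous_on_subset by blast

text \<open>Skew-adjointness of the twisted derivative, with a weight: the divergence term
  \<open>(n - 1) coth \<rho>\<close> of the product \<open>f g\<close> is shared equally by
  \<open>Rt f f'\<close> and \<open>Rt g g'\<close>.\<close>

lemma hint_energy:
  assumes f: "C1c K f f'" and g: "C1c K g g'" and \<psi>: "radw \<psi> \<psi>'"
  shows "hint (\<lambda>x. \<psi> x * (f x * Rt g g' x) + \<psi> x * (g x * Rt f f' x) + \<psi>' x * (f x * g x)) = 0"
proof -
  have "hint (\<lambda>x. \<psi> x * ((g x * f' x x + g' x x * f x) / sinh (hrho x) + (real DIM('a) - 1) * coth_rho x * (g x * f x))
     + \<psi>' x * (g x * f x)) = 0"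
    by (rule hint_radial_divergence(1)[OF C1c_mult[OF f g K(1)] \<psi>])
  moreover have "\<psi> x * ((g x * f' x x + g' x x * f x) / sinh (hrho x) + (real DIM('a) - 1) * coth_rho x * (g x * f x))
     + \<psi>' x * (g x * f x) = \<psi> x * (f x * Rt g g' x) + \<psi> x * (g x * Rt f f' x) + \<psi>' x * (f x * g x)" for x
    unfolding Rt_def by (simp add: algebra_simps add_divide_distrib diff_divide_distrib)
  ultimately show ?thesis by simp
qed

text \<open>Expand the nonnegative integral of \<open>\<phi> (T f + g f)\<^sup>2\<close> and
  integrate the cross term by parts. The function \<open>g\<close> is taken as
  \<open>- h' / h\<close> for a virtual extremal \<open>h\<close>; in the three instances below
  \<open>h\<close> is \<open>\<rho>^(1/2)\<close>, \<open>\<rho>^(3/2)\<close> and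
  \<open>\<rho>^(1/2) sinh \<rho>\<close>.\<close>

lemma hardy:
  assumes f: "C1c K f f'" and \<psi>: "radw (\<lambda>x. \<phi> x * g x) \<psi>'"
    and c: "continuous_on pball \<phi>" "continuous_on pball g" and pos: "\<And>x. x \<in> pball \<Longrightarrow> 0 \<le> \<phi> x"
  shows "hint (\<lambda>x. (\<psi>' x - \<phi> x * (g x)\<^sup>2) * (f x)\<^sup>2) \<le> hint (\<lambda>x. \<phi> x * (Rt f f' x)\<^sup>2)"
proof -
  note cc = C1c_Cc[OF f] Rt_Cc[OF f] continuous_K[OF c(1)] continuous_K[OF c(2)] radw_continuous_K[OF \<psi>]
  have C1: "Cc K (\<lambda>x. (\<psi>' x - \<phi> x * (g x)\<^sup>2) * (f x)\<^sup>2)"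
    by (intro Cc_mult2 Cc_power2 cc continuous_intros)
  have C2: "Cc K (\<lambda>x. \<phi> x * (Rt f f' x)\<^sup>2)"
    by (intro Cc_mult2 Cc_power2 cc)
  have C3: "Cc K (\<lambda>x. \<phi> x * g x * (f x * Rt f f' x) + \<phi> x * g x * (f x * Rt f f' x) + \<psi>' x * (f x * f x))"
    by (intro Cc_add Cc_mult2 Cc_prod cc)
  have "0 \<le> hint (\<lambda>x. \<phi> x * (Rt f f' x + g x * f x)\<^sup>2)"
  proof (rule hint_nonneg)
    show "Cc K (\<lambda>x. \<phi> x * (Rt f f' x + g x * f x)\<^sup>2)"
      by (intro Cc_mult2 Cc_power2 Cc_add cc)
    show "0 \<le> \<phi> x * (Rt f f' x + g x * f x)\<^sup>2" if "x \<in> K" for x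
      using pos[of x] K that by (simp add: subset_iff)
  qed
  also have "(\<lambda>x. \<phi> x * (Rt f f' x + g x * f x)\<^sup>2) = (\<lambda>x. \<phi> x * (Rt f f' x)\<^sup>2 - (\<psi>' x - \<phi> x * (g x)\<^sup>2) * (f x)\<^sup>2
     + (\<phi> x * g x * (f x * Rt f f' x) + \<phi> x * g x * (f x * Rt f f' x) + \<psi>' x * (f x * f x)))"
    by (rule ext) (simp add: power2_eq_square algebra_simps)
  also have "hint \<dots> = hint (\<lambda>x. \<phi> x * (Rt f f' x)\<^sup>2) - hint (\<lambda>x. (\<psi>' x - \<phi> x * (g x)\<^sup>2) * (f x)\<^sup>2)"
    unfolding hint_add[OF Cc_diff[OF C2 C1] C3] hint_diff[OF C2 C1] hint_energy[OF f f \<psi>] by simp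
  finally show ?thesis by simp
qed

lemma hardy_cong:
  assumes "C1c K f f'" "radw (\<lambda>x. \<phi> x * g x) \<psi>'"
    "continuous_on pball \<phi>" "continuous_on pball g" "\<And>x. x \<in> pball \<Longrightarrow> 0 \<le> \<phi> x"
    "\<And>x. x \<in> pball \<Longrightarrow> \<psi>' x - \<phi> x * (g x)\<^sup>2 = w x"
  shows "hint (\<lambda>x. w x * (f x)\<^sup>2) \<le> hint (\<lambda>x. \<phi> x * (Rt f f' x)\<^sup>2)"
proof -
  have "(\<lambda>x. (\<psi>' x - \<phi> x * (g x)\<^sup>2) * (f x)\<^sup>2) = (\<lambda>x. w x * (f x)\<^sup>2)"
  proof
    show "(\<psi>' x - \<phi> x * (g x)\<^sup>2) * (f x)\<^sup>2 = w x * (f x)\<^sup>2" for x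
      using assms(1) assms(6)[of x] K by (cases "x \<in> K") (auto simp: C1c_def subset_iff)
  qed
  with hardy[OF assms(1-5)] show ?thesis by simp
qed

lemma hardy_plain:
  assumes f: "C1c K f f'"
  shows "hint (\<lambda>x. (1/4 * (1 / (hrho x)\<^sup>2)) * (f x)\<^sup>2) \<le> hint (\<lambda>x. 1 * (Rt f f' x)\<^sup>2)"
proof (rule hardy_cong[OF f])
  show "radw (\<lambda>x::'a. 1 * (- 1/2 * (1 / hrho x ^ 1))) (\<lambda>x. - 1/2 * - (real 1 / hrho x ^ Suc 1))"
    unfolding mult_1 by (rule radw_cmult[OF radw_inverse_hrho_power])
  show "continuous_on pball (\<lambda>x::'a. - 1/2 * (1 / hrho x ^ 1))"
    by (intro continuous_intros radw_continuous[OF radw_inverse_hrho_power])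
qed (auto simp: power2_eq_square)

lemma hardy_inverse_square:
  assumes f: "C1c K f f'"
  shows "hint (\<lambda>x. (9/4 * (1 / hrho x ^ 4)) * (f x)\<^sup>2) \<le> hint (\<lambda>x. 1 / (hrho x)\<^sup>2 * (Rt f f' x)\<^sup>2)"
proof (rule hardy_cong[OF f])
  have "(\<lambda>x::'a. 1 / (hrho x)\<^sup>2 * (- 3/2 * (1 / hrho x ^ 1))) = (\<lambda>x. - 3/2 * (1 / hrho x ^ 3))"
    by (rule ext) (simp add: power2_eq_square power3_eq_cube)
  then show "radw (\<lambda>x::'a. 1 / (hrho x)\<^sup>2 * (- 3/2 * (1 / hrho x ^ 1))) (\<lambda>x. - 3/2 * - (real 3 / hrho x ^ Suc 3))"
    by (simp only:) (rule radw_cmult[OF radw_inverse_hrho_power])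
  show "continuous_on pball (\<lambda>x::'a. - 3/2 * (1 / hrho x ^ 1))"
    by (intro continuous_intros radw_continuous[OF radw_inverse_hrho_power])
  show "continuous_on pball (\<lambda>x::'a. 1 / (hrho x)\<^sup>2)"
    by (rule radw_continuous[OF radw_inverse_hrho_power])
qed (auto simp: power2_eq_square eval_nat_numeral)

lemma hardy_phi:
  assumes f: "C1c K f f'"
  shows "hint (\<lambda>x. (phi x + 2 * (phi x)\<^sup>2 + 1/4 * (phi x * (1 / (hrho x)\<^sup>2))) * (f x)\<^sup>2) \<le> hint (\<lambda>x. phi x * (Rt f f' x)\<^sup>2)"
proof (rule hardy_cong[OF f])
  \<comment> \<open>The logarithmic derivative of \<open>\<rho>^(1/2) sinh \<rho>\<close> with
    reversed sign: \<open>sinh \<rho>\<close> compensates the weight \<open>phi\<close>, and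
    \<open>\<rho>^(1/2)\<close> contributes the plain Hardy term.\<close>
  have g: "radw (\<lambda>x::'a. (-1) * coth_rho x + (-1/2) * (1 / hrho x ^ 1))
     (\<lambda>x. (-1) * - (1 / (sinh (hrho x))\<^sup>2) + (-1/2) * - (real 1 / hrho x ^ Suc 1))"
    by (intro radw_add radw_cmult radw_inverse_hrho_power radw_coth)
  show "radw (\<lambda>x::'a. phi x * ((-1) * coth_rho x + (-1/2) * (1 / hrho x ^ 1)))
     (\<lambda>x. phi x * ((-1) * - (1 / (sinh (hrho x))\<^sup>2) + (-1/2) * - (real 1 / hrho x ^ Suc 1))
       + - 2 * (coth_rho x * phi x) * ((-1) * coth_rho x + (-1/2) * (1 / hrho x ^ 1)))"
    by (rule radw_mult[OF radw_phi g])
  show "continuous_on pball (\<lambda>x::'a. (-1) * coth_rho x + (-1/2) * (1 / hrho x ^ 1))"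
    by (rule radw_continuous[OF g])
  show "continuous_on pball phi" by (rule radw_continuous[OF radw_phi])
  fix x :: 'a assume x: "x \<in> pball"
  have "phi x * ((-1) * - (1 / (sinh (hrho x))\<^sup>2) + (-1/2) * - (real 1 / hrho x ^ Suc 1))
       + - 2 * (coth_rho x * phi x) * ((-1) * coth_rho x + (-1/2) * (1 / hrho x ^ 1))
       - phi x * ((-1) * coth_rho x + (-1/2) * (1 / hrho x ^ 1))\<^sup>2
      = phi x * (phi x + (coth_rho x)\<^sup>2 + 1/4 * (1 / (hrho x)\<^sup>2))"
    unfolding phi_def[symmetric] using hrho_pos[OF x] by (simp add: power2_eq_square field_simps)
  also have "\<dots> = phi x + 2 * (phi x)\<^sup>2 + 1/4 * (phi x * (1 / (hrho x)\<^sup>2))"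
    unfolding coth_rho_square[OF x] by (simp add: power2_eq_square algebra_simps)
  finally show "phi x * ((-1) * - (1 / (sinh (hrho x))\<^sup>2) + (-1/2) * - (real 1 / hrho x ^ Suc 1))
       + - 2 * (coth_rho x * phi x) * ((-1) * coth_rho x + (-1/2) * (1 / hrho x ^ 1))
       - phi x * ((-1) * coth_rho x + (-1/2) * (1 / hrho x ^ 1))\<^sup>2 = phi x + 2 * (phi x)\<^sup>2 + 1/4 * (phi x * (1 / (hrho x)\<^sup>2))" .
qed (rule phi_nonneg)

lemma hint_skew_ibp:
  assumes f: "C1c K f f'" and g: "C1c K g g'" and \<psi>: "radw \<psi> \<psi>'" and A: "skew A"
  shows "hint (\<lambda>x. \<psi> x * (f x * g' x (A x)) + \<psi> x * (g x * f' x (A x))) = 0"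
  using hint_skew_divergence[OF C1c_mult[OF f g K(1)] \<psi> A] by (simp add: algebra_simps)

lemma hint_swap_Rt:
  assumes f: "C1c K f f'" and g: "C1c K g g'" and \<psi>: "radw \<psi> \<psi>'" and A: "skew A"
  shows "hint (\<lambda>x. \<psi> x * (Rt f f' x * g' x (A x)) - \<psi> x * (f' x (A x) * Rt g g' x) + \<psi>' x * (f x * g' x (A x))) = 0"
proof -
  define c where "c = (real DIM('a) - 1) / 2"
  note R = radw_mult[OF radw_cmult[OF radw_coth, of c] \<psi>]
  \<comment> \<open>\<open>G\<close> is \<open>c coth_rho \<psi>\<close> times the derivative of
    \<open>f g\<close> along \<open>A\<close>, hence of integral zero. Adding it turns the twisted
    derivatives of \<open>F\<close> into the untwisted ones of the radial exchange.\<close>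
  define F G where "F x = \<psi> x * (Rt f f' x * g' x (A x)) - \<psi> x * (f' x (A x) * Rt g g' x) + \<psi>' x * (f x * g' x (A x))"
    and "G x = (c * coth_rho x * \<psi> x) * (f x * g' x (A x)) + (c * coth_rho x * \<psi> x) * (g x * f' x (A x))" for x
  note cc = C1c_Cc[OF f] C1c_Cc[OF g] Rt_Cc[OF f] Rt_Cc[OF g] skew_Cc[OF f A] skew_Cc[OF g A] radw_continuous_K[OF \<psi>] radw_continuous_K(1)[OF R]
  have C: "Cc K F" "Cc K G"
    unfolding F_def[abs_def] G_def[abs_def] by (intro Cc_add Cc_diff Cc_mult2 Cc_prod cc)+
  have "hint G = 0"
    unfolding G_def by (rule hint_skew_ibp[OF f g R A])
  moreover have "hint (\<lambda>x. F x + G x) = 0"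
  proof -
    have "F x + G x = \<psi> x * ((f' x x * g' x (A x) - f' x (A x) * g' x x) / sinh (hrho x))
       + f x * ((\<psi>' x + (real DIM('a) - 1) * coth_rho x * \<psi> x) * g' x (A x))" for x
    proof -
      have n: "real DIM('a) - 1 = 2 * c" by (simp add: c_def)
      show ?thesis
        unfolding F_def G_def Rt_def n
        by (simp add: algebra_simps diff_divide_distrib)
    qed
    then show ?thesis using hint_radial_divergence(2)[OF f \<psi> g A] by simp
  qed
  ultimately show ?thesis using hint_add[OF C] unfolding F_def by simp
qed

end

section \<open>The radial part and the mixed terms\<close>

lemma radw_C1on: "radw \<psi> \<psi>' \<Longrightarrow> C1on pball \<psi> (\<lambda>x v. \<psi>' x * (conf x / norm x) * (x \<bullet> v))"
  by (auto simp: radw_def C1on_def intro!: continuous_intros continuous_on_conf)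

locale C2c_pball = compact_pball K for K :: "'a::euclidean_space set" +
  fixes u :: "'a \<Rightarrow> real" and u' u''
  assumes u: "C2c K u u' u''"
begin

lemma u_C1c: "C1c K u u'"
  using u by (simp add: C2c_def)

definition p :: "'a \<Rightarrow> real" where
  "p = Rt u u'"

definition p' :: "'a \<Rightarrow> 'a \<Rightarrow> real" where
  "p' x v = (u'' x ((1 / sinh (hrho x)) *\<^sub>R x) v
      + u' x ((1 / sinh (hrho x)) *\<^sub>R v + (- (coth_rho x / sinh (hrho x)) * (conf x / norm x) * (x \<bullet> v)) *\<^sub>R x))
    + ((real DIM('a) - 1) / 2 * coth_rho x * u' x v
      + ((real DIM('a) - 1) / 2 * - (1 / (sinh (hrho x))\<^sup>2)) * (conf x / norm x) * (x \<bullet> v) * u x)"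

definition q :: "('a \<Rightarrow> 'a) \<Rightarrow> 'a \<Rightarrow> real" where
  "q A x = u' x (A x)"

definition q' :: "('a \<Rightarrow> 'a) \<Rightarrow> 'a \<Rightarrow> 'a \<Rightarrow> real" where
  "q' A x v = u'' x (A x) v + u' x (A v)"

lemma p_C1c: "C1c K p p'"
proof -
  note X = radw_field[OF radw_inverse_sinh linear_id, unfolded id_apply, where 'a='a]
  note c = radw_C1on[OF radw_cmult[OF radw_coth, of "(real DIM('a) - 1) / 2"], where 'a='a]
  have "p x = u' x ((1 / sinh (hrho x)) *\<^sub>R x) + (real DIM('a) - 1) / 2 * coth_rho x * u x" for x
    by (simp add: p_def Rt_def linear_scale[OF C1c_linear[OF u_C1c]])
  then have "p = (\<lambda>x. u' x ((1 / sinh (hrho x)) *\<^sub>R x) + (real DIM('a) - 1) / 2 * coth_rho x * u x)"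
    by (rule ext)
  then show ?thesis
    using C1c_add[OF C2c_deriv_field[OF u X K open_pball]
        C1c_mult_C1on[OF u_C1c c K open_pball]]
    by (simp only: p'_def[abs_def])
qed

lemma q_C1c:
  assumes "skew A"
  shows "C1c K (q A) (q' A)"
proof -
  have A: "(A has_derivative A) F" for F
    using assms by (auto intro: bounded_linear_imp_has_derivative simp: linear_linear skew_def)
  then have "C1field pball A (\<lambda>x. A)" by (simp add: C1field_def)
  from C2c_deriv_field[OF u this K open_pball] show ?thesis
    by (simp add: q_def[abs_def] q'_def[abs_def])
qed

lemma u_linear: "linear (u' x)" "linear (u'' x v)" "linear (\<lambda>v. u'' x v w)"
  using C1c_linear[OF u_C1c] C2c_linear[OF u] by auto

text \<open>Rotations annihilate the radial coefficients of \<open>T\<close> and commute with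
  dilations, so \<open>A (T u) = T (A u)\<close>; the second-order terms agree by the symmetry of
  \<open>u''\<close>.\<close>

lemma p'_skew:
  assumes "skew A"
  shows "p' x (A x) = Rt (q A) (q' A) x"
proof -
  have "x \<bullet> A x = 0" using assms by (simp add: skew_def)
  then show ?thesis
    unfolding p'_def Rt_def q_def q'_def C2c_symmetric[OF u, of x _ "A x"]
    by (simp add: linear_scale[OF u_linear(1)] linear_scale[OF u_linear(2)] add_divide_distrib)
qed

text \<open>With \<open>c = (n - 1) / 2\<close> the zeroth-order part is
  \<open>c\<^sup>2 coth\<^sup>2 - c phi\<close>; since \<open>coth\<^sup>2 = 1 + phi\<close>, it
  equals the potential \<open>c\<^sup>2 + (c\<^sup>2 - c) phi\<close> that the Laplacian does not
  contain.\<close>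

lemma Rt_p:
  assumes "x \<in> pball"
  shows "Rt p p' x = phi x * (u'' x x x + u' x x) + (real DIM('a) - 2) * coth_rho x / sinh (hrho x) * u' x x
    + ((real DIM('a) - 1)\<^sup>2 / 4 + (real DIM('a) - 1) * (real DIM('a) - 3) / 4 * phi x) * u x"
proof -
  define s c where "s = sinh (hrho x)" and "c = (real DIM('a) - 1) / 2"
  have s: "s > 0" using sinh_hrho_pos[OF assms] by (simp add: s_def)
  have cn: "conf x / norm x * (x \<bullet> x) = s"
    using pball_norm[OF assms] by (simp add: s_def sinh_hrho[OF assms] power2_eq_square flip: power2_norm_eq_inner)
  have d: "real DIM('a) = 2 * c + 1" by (simp add: c_def field_simps)
  have "p' x x = (u'' x x x + u' x x) / s - coth_rho x * u' x x + (c * coth_rho x * u' x x - c * u x / s)"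
    unfolding p'_def s_def[symmetric] c_def[symmetric] mult.assoc[of _ "conf x / norm x"] cn
    using s by (simp add: linear_scale[OF u_linear(1)] linear_add[OF u_linear(1)] linear_scale[OF u_linear(3)] power2_eq_square)
      (simp add: linear_diff[OF u_linear(1)] linear_scale[OF u_linear(1)] add_divide_distrib)
  then have "Rt p p' x = ((u'' x x x + u' x x) / s - coth_rho x * u' x x + (c * coth_rho x * u' x x - c * u x / s)) / s
      + c * coth_rho x * (u' x x / s + c * coth_rho x * u x)"
    by (simp add: Rt_def p_def s_def c_def)
  also have "\<dots> = 1 / s\<^sup>2 * (u'' x x x + u' x x) + (2 * c - 1) * coth_rho x / s * u' x x
     - c * (1 / s\<^sup>2) * u x + c\<^sup>2 * (coth_rho x)\<^sup>2 * u x"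
    using s by (simp add: field_simps power2_eq_square)
  finally show ?thesis
    unfolding coth_rho_square[OF assms] phi_def s_def[symmetric] d
    by (simp add: algebra_simps power2_eq_square diff_divide_distrib)
qed

lemma u_Cc: "Cc K u" "Cc K p" "Cc K (Rt p p')"
  using C1c_Cc[OF u_C1c] C1c_Cc[OF p_C1c] Rt_Cc[OF p_C1c] by auto

lemma phi_continuous: "continuous_on K phi"
  by (rule radw_continuous_K(1)[OF radw_phi])

lemma inverse_hrho_continuous: "continuous_on K (\<lambda>x. 1 / hrho x ^ k)"
  by (rule radw_continuous_K(1)[OF radw_inverse_hrho_power])

text \<open>For \<open>V = a + b phi\<close>, integration by parts turns the right side into the
  integral of \<open>(T p)\<^sup>2 + 2 V p\<^sup>2 - V'' u\<^sup>2 + V\<^sup>2 u\<^sup>2\<close>.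
  Hardy inequalities bound the first two terms, the second with the weights 1 and
  \<open>phi\<close>; the signs of \<open>a\<close> and \<open>b\<close> are used only
  there.\<close>

lemma radial_inequality:
  assumes "a \<ge> 0" "b \<ge> 0"
  shows "hint (\<lambda>x. (a\<^sup>2 + a / 2 * (1 / (hrho x)\<^sup>2) + 9/16 * (1 / hrho x ^ 4) + (b\<^sup>2 - 2 * b) * (phi x)\<^sup>2
      + (2 * a * b - 2 * b) * phi x + b / 2 * (phi x * (1 / (hrho x)\<^sup>2))) * (u x)\<^sup>2)
    \<le> hint (\<lambda>x. (Rt p p' x - (a + b * phi x) * u x)\<^sup>2)"
proof -
  define V V' V'' where "V x = a + b * phi x" and "V' x = 0 + b * (- 2 * (coth_rho x * phi x))"
    and "V'' x = 0 + b * (4 * phi x + 6 * (phi x)\<^sup>2)" for x :: 'a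
  have V: "radw V V'" unfolding V_def[abs_def] V'_def[abs_def] by (intro radw_add radw_const radw_cmult radw_phi)
  have V': "radw V' V''" unfolding V'_def[abs_def] V''_def[abs_def] by (intro radw_add radw_const radw_cmult radw_phi')
  note cc = u_Cc phi_continuous inverse_hrho_continuous radw_continuous_K[OF V] radw_continuous_K[OF V']
  have pR: "p x = Rt u u' x" for x by (simp add: p_def)
  have e1: "hint (\<lambda>x. V x * (u x * Rt p p' x) + V x * (p x * p x) + V' x * (u x * p x)) = 0"
    using hint_energy[OF u_C1c p_C1c V] unfolding pR .
  have e2: "hint (\<lambda>x. V' x * (u x * p x) + V' x * (u x * p x) + V'' x * (u x * u x)) = 0"
    using hint_energy[OF u_C1c u_C1c V'] unfolding pR .
  have C: "Cc K (\<lambda>x. V x * (u x * Rt p p' x))" "Cc K (\<lambda>x. V x * (p x * p x))" "Cc K (\<lambda>x. V' x * (u x * p x))"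
      "Cc K (\<lambda>x. V'' x * (u x * u x))" "Cc K (\<lambda>x. (Rt p p' x)\<^sup>2)" "Cc K (\<lambda>x. (V x)\<^sup>2 * (u x)\<^sup>2)"
    by (intro Cc_mult2 Cc_prod Cc_power2 cc continuous_intros)+
  have e1': "hint (\<lambda>x. V x * (u x * Rt p p' x)) + hint (\<lambda>x. V x * (p x * p x)) + hint (\<lambda>x. V' x * (u x * p x)) = 0"
    using e1 by (simp add: hint_add C Cc_add)
  have e2': "2 * hint (\<lambda>x. V' x * (u x * p x)) + hint (\<lambda>x. V'' x * (u x * u x)) = 0"
    using e2 unfolding hint_add[OF Cc_add[OF C(3) C(3)] C(4)] hint_add[OF C(3) C(3)] by simp
  have "hint (\<lambda>x. (Rt p p' x - V x * u x)\<^sup>2) = hint (\<lambda>x. (Rt p p' x)\<^sup>2 - 2 * (V x * (u x * Rt p p' x)) + (V x)\<^sup>2 * (u x)\<^sup>2)"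
    by (rule arg_cong[where f=hint], rule ext) (simp add: power2_eq_square algebra_simps)
  also have "\<dots> = hint (\<lambda>x. (Rt p p' x)\<^sup>2) - 2 * hint (\<lambda>x. V x * (u x * Rt p p' x)) + hint (\<lambda>x. (V x)\<^sup>2 * (u x)\<^sup>2)"
    unfolding hint_add[OF Cc_diff[OF C(5) Cc_cmult[OF C(1)]] C(6)] hint_diff[OF C(5) Cc_cmult[OF C(1)]] hint_cmult ..
  also have "\<dots> = hint (\<lambda>x. (Rt p p' x)\<^sup>2) + 2 * hint (\<lambda>x. V x * (p x * p x)) - hint (\<lambda>x. V'' x * (u x * u x))
      + hint (\<lambda>x. (V x)\<^sup>2 * (u x)\<^sup>2)"
    using e1' e2' by simp
  finally have eq: "hint (\<lambda>x. (Rt p p' x - V x * u x)\<^sup>2) = \<dots>" .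
  have D: "Cc K (\<lambda>x. (p x)\<^sup>2)" "Cc K (\<lambda>x. phi x * (p x)\<^sup>2)" 
    by (intro Cc_mult2 Cc_power2 cc continuous_intros)+
  have W: "Cc K (\<lambda>x. w x * (u x)\<^sup>2)" if "continuous_on K w" for w
    by (intro Cc_mult2 Cc_power2 cc that)
  \<comment> \<open>\<open>9/16 = 1/4 * 9/4\<close>: the plain Hardy inequality for
    \<open>p = T u\<close>, followed by the one with weight \<open>1 / \<rho>\<^sup>2\<close> for
    \<open>u\<close>.\<close>
  have "hint (\<lambda>x. 1/4 * (9/4 * (1 / hrho x ^ 4) * (u x)\<^sup>2)) \<le> hint (\<lambda>x. 1/4 * (1 / (hrho x)\<^sup>2 * (p x)\<^sup>2))"
    using hardy_inverse_square[OF u_C1c] unfolding hint_cmult pR by simp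
  also have "\<dots> \<le> hint (\<lambda>x. (Rt p p' x)\<^sup>2)"
    using hardy_plain[OF p_C1c] by (simp add: mult.assoc)
  finally have h1: "hint (\<lambda>x. 9/16 * (1 / hrho x ^ 4) * (u x)\<^sup>2) \<le> hint (\<lambda>x. (Rt p p' x)\<^sup>2)"
    by (simp add: mult.assoc)
  have "2 * hint (\<lambda>x. V x * (p x * p x)) = hint (\<lambda>x. 2 * a * (p x)\<^sup>2 + 2 * b * (phi x * (p x)\<^sup>2))"
    unfolding hint_cmult[symmetric] by (rule arg_cong[where f=hint], rule ext) (simp add: V_def power2_eq_square algebra_simps)
  also have "\<dots> = 2 * a * hint (\<lambda>x. (p x)\<^sup>2) + 2 * b * hint (\<lambda>x. phi x * (p x)\<^sup>2)"
    unfolding hint_add[OF Cc_cmult[OF D(1)] Cc_cmult[OF D(2)]] hint_cmult ..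
  finally have v: "2 * hint (\<lambda>x. V x * (p x * p x)) = \<dots>" .
  have h2: "2 * a * hint (\<lambda>x. (1/4 * (1 / (hrho x)\<^sup>2)) * (u x)\<^sup>2) \<le> 2 * a * hint (\<lambda>x. (p x)\<^sup>2)"
    using hardy_plain[OF u_C1c] assms unfolding pR by (intro mult_left_mono) auto
  have h3: "2 * b * hint (\<lambda>x. (phi x + 2 * (phi x)\<^sup>2 + 1/4 * (phi x * (1 / (hrho x)\<^sup>2))) * (u x)\<^sup>2) \<le> 2 * b * hint (\<lambda>x. phi x * (p x)\<^sup>2)"
    using hardy_phi[OF u_C1c] assms unfolding pR by (intro mult_left_mono) auto
  have "hint (\<lambda>x. (a\<^sup>2 + a / 2 * (1 / (hrho x)\<^sup>2) + 9/16 * (1 / hrho x ^ 4) + (b\<^sup>2 - 2 * b) * (phi x)\<^sup>2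
      + (2 * a * b - 2 * b) * phi x + b / 2 * (phi x * (1 / (hrho x)\<^sup>2))) * (u x)\<^sup>2)
    = hint (\<lambda>x. 9/16 * (1 / hrho x ^ 4) * (u x)\<^sup>2 + 2 * a * ((1/4 * (1 / (hrho x)\<^sup>2)) * (u x)\<^sup>2)
       + 2 * b * ((phi x + 2 * (phi x)\<^sup>2 + 1/4 * (phi x * (1 / (hrho x)\<^sup>2))) * (u x)\<^sup>2) - V'' x * (u x * u x) + (V x)\<^sup>2 * (u x)\<^sup>2)"
    by (rule arg_cong[where f=hint], rule ext) (simp add: V_def V''_def power2_eq_square algebra_simps)
  also have "\<dots> = hint (\<lambda>x. 9/16 * (1 / hrho x ^ 4) * (u x)\<^sup>2) + 2 * a * hint (\<lambda>x. (1/4 * (1 / (hrho x)\<^sup>2)) * (u x)\<^sup>2)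
       + 2 * b * hint (\<lambda>x. (phi x + 2 * (phi x)\<^sup>2 + 1/4 * (phi x * (1 / (hrho x)\<^sup>2))) * (u x)\<^sup>2)
       - hint (\<lambda>x. V'' x * (u x * u x)) + hint (\<lambda>x. (V x)\<^sup>2 * (u x)\<^sup>2)"
  proof -
    have c: "continuous_on K (\<lambda>x. 9/16 * (1 / hrho x ^ 4))" "continuous_on K (\<lambda>x. 1/4 * (1 / (hrho x)\<^sup>2))"
      "continuous_on K (\<lambda>x. phi x + 2 * (phi x)\<^sup>2 + 1/4 * (phi x * (1 / (hrho x)\<^sup>2)))"
      by (intro continuous_on_add continuous_on_mult continuous_on_power continuous_on_const cc)+
    note w = W[OF c(1)] Cc_cmult[OF W[OF c(2)], of "2*a"] Cc_cmult[OF W[OF c(3)], of "2*b"]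
    show ?thesis
      unfolding hint_add[OF Cc_diff[OF Cc_add[OF Cc_add[OF w(1,2)] w(3)] C(4)] C(6)]
        hint_diff[OF Cc_add[OF Cc_add[OF w(1,2)] w(3)] C(4)] hint_add[OF Cc_add[OF w(1,2)] w(3)]
        hint_add[OF w(1,2)] hint_cmult[of "2*a"] hint_cmult[of "2*b"] ..
  qed
  also have "\<dots> \<le> hint (\<lambda>x. (Rt p p' x - V x * u x)\<^sup>2)"
    unfolding eq v using h1 h2 h3 by simp
  finally show ?thesis by (simp only: V_def)
qed

text \<open>Put \<open>f = A u\<close>. Exchanging \<open>T\<close> and \<open>A\<close> between
  \<open>p\<close> and \<open>f\<close> turns \<open>2 phi (T p) (A f)\<close> into
  \<open>2 phi (T f)\<^sup>2 - phi'' f\<^sup>2\<close> under the integral, and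
  \<open>- 2 V u (A f)\<close> becomes \<open>2 V f\<^sup>2\<close>. Hardy with weight
  \<open>phi\<close> for \<open>f\<close> does the rest; the two occurrences of \<open>- 2\<close>
  are \<open>2 * 1 - 4\<close> and \<open>2 * 2 - 6\<close>.\<close>

lemma cross_inequality:
  assumes A: "skew A"
  shows "hint (\<lambda>x. ((2 * a - 2) * phi x + (2 * b - 2) * (phi x)\<^sup>2 + 1/2 * (phi x * (1 / (hrho x)\<^sup>2))) * (q A x)\<^sup>2)
    \<le> hint (\<lambda>x. 2 * (phi x * ((Rt p p' x - (a + b * phi x) * u x) * q' A x (A x))))"
proof -
  define V where "V x = a * phi x + b * (phi x * phi x)" for x :: 'a
  obtain V' where V: "radw V V'" unfolding V_def[abs_def] using radw_add[OF radw_cmult[OF radw_phi] radw_cmult[OF radw_mult[OF radw_phi radw_phi]]] by blast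
  define f f' where "f = q A" and "f' = q' A"
  have f1: "C1c K f f'" unfolding f_def f'_def by (rule q_C1c[OF A])
  define d where "d x = - 2 * (coth_rho x * phi x)" for x :: 'a
  define e where "e x = 4 * phi x + 6 * (phi x)\<^sup>2" for x :: 'a
  have d: "radw phi d" "radw d e" using radw_phi radw_phi' by (auto simp: d_def[abs_def] e_def[abs_def])
  define L where "L x = f' x (A x)" for x
  have L: "Cc K L" unfolding L_def[abs_def] by (rule skew_Cc[OF f1 A])
  note cc = u_Cc L C1c_Cc[OF f1] Rt_Cc[OF f1] phi_continuous inverse_hrho_continuous radw_continuous_K[OF V] radw_continuous_K[OF d(1)] radw_continuous_K[OF d(2)]
  have pA: "p' x (A x) = Rt f f' x" for x unfolding f_def f'_def by (rule p'_skew[OF A])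
  have uA: "u' x (A x) = f x" for x by (simp add: f_def q_def)
  have C: "Cc K (\<lambda>x. phi x * (Rt p p' x * L x))" "Cc K (\<lambda>x. phi x * (Rt f f' x * Rt f f' x))" "Cc K (\<lambda>x. d x * (p x * L x))"
     "Cc K (\<lambda>x. d x * (f x * Rt f f' x))" "Cc K (\<lambda>x. e x * (f x * f x))" "Cc K (\<lambda>x. V x * (u x * L x))" "Cc K (\<lambda>x. V x * (f x * f x))"
    by (intro Cc_mult2 Cc_prod cc)+
  have "hint (\<lambda>x. phi x * (Rt p p' x * L x) - phi x * (Rt f f' x * Rt f f' x) + d x * (p x * L x)) = 0"
    using hint_swap_Rt[OF p_C1c f1 d(1) A] unfolding pA L_def .
  then have 1: "hint (\<lambda>x. phi x * (Rt p p' x * L x)) - hint (\<lambda>x. phi x * (Rt f f' x * Rt f f' x)) + hint (\<lambda>x. d x * (p x * L x)) = 0"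
    unfolding hint_add[OF Cc_diff[OF C(1,2)] C(3)] hint_diff[OF C(1,2)] .
  have "hint (\<lambda>x. d x * (p x * L x) + d x * (f x * Rt f f' x)) = 0"
    using hint_skew_ibp[OF p_C1c f1 d(2) A] unfolding pA L_def .
  then have 2: "hint (\<lambda>x. d x * (p x * L x)) + hint (\<lambda>x. d x * (f x * Rt f f' x)) = 0"
    unfolding hint_add[OF C(3,4)] .
  have 3: "hint (\<lambda>x. d x * (f x * Rt f f' x)) + hint (\<lambda>x. d x * (f x * Rt f f' x)) + hint (\<lambda>x. e x * (f x * f x)) = 0"
    using hint_energy[OF f1 f1 d(2)] unfolding hint_add[OF Cc_add[OF C(4,4)] C(5)] hint_add[OF C(4,4)] .
  have "hint (\<lambda>x. V x * (u x * L x) + V x * (f x * f x)) = 0"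
    using hint_skew_ibp[OF u_C1c f1 V A] unfolding uA L_def .
  then have 4: "hint (\<lambda>x. V x * (u x * L x)) + hint (\<lambda>x. V x * (f x * f x)) = 0"
    unfolding hint_add[OF C(6,7)] .
  have c: "continuous_on K (\<lambda>x. phi x + 2 * (phi x)\<^sup>2 + 1/4 * (phi x * (1 / (hrho x)\<^sup>2)))"
    by (intro continuous_on_add continuous_on_mult continuous_on_power continuous_on_const cc)
  have H: "Cc K (\<lambda>x. (phi x + 2 * (phi x)\<^sup>2 + 1/4 * (phi x * (1 / (hrho x)\<^sup>2))) * (f x)\<^sup>2)"
    by (intro Cc_mult2 Cc_power2 cc c)
  have "hint (\<lambda>x. ((2 * a - 2) * phi x + (2 * b - 2) * (phi x)\<^sup>2 + 1/2 * (phi x * (1 / (hrho x)\<^sup>2))) * (q A x)\<^sup>2)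
     = hint (\<lambda>x. 2 * ((phi x + 2 * (phi x)\<^sup>2 + 1/4 * (phi x * (1 / (hrho x)\<^sup>2))) * (f x)\<^sup>2) - e x * (f x * f x) + 2 * (V x * (f x * f x)))"
    by (rule arg_cong[where f=hint], rule ext) (simp add: V_def e_def f_def power2_eq_square algebra_simps)
  also have "\<dots> = 2 * hint (\<lambda>x. (phi x + 2 * (phi x)\<^sup>2 + 1/4 * (phi x * (1 / (hrho x)\<^sup>2))) * (f x)\<^sup>2) - hint (\<lambda>x. e x * (f x * f x)) + 2 * hint (\<lambda>x. V x * (f x * f x))"
    unfolding hint_add[OF Cc_diff[OF Cc_cmult[OF H, of 2] C(5)] Cc_cmult[OF C(7), of 2]] hint_diff[OF Cc_cmult[OF H, of 2] C(5)] hint_cmult[of 2] ..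
  also have "\<dots> \<le> 2 * hint (\<lambda>x. phi x * (Rt f f' x * Rt f f' x)) - hint (\<lambda>x. e x * (f x * f x)) + 2 * hint (\<lambda>x. V x * (f x * f x))"
    using hardy_phi[OF f1] by (simp add: power2_eq_square)
  also have "\<dots> = 2 * hint (\<lambda>x. phi x * (Rt p p' x * L x)) - 2 * hint (\<lambda>x. V x * (u x * L x))"
    using 1 2 3 4 by simp
  also have "\<dots> = hint (\<lambda>x. 2 * (phi x * (Rt p p' x * L x)) - 2 * (V x * (u x * L x)))"
    unfolding hint_diff[OF Cc_cmult[OF C(1)] Cc_cmult[OF C(6)]] hint_cmult[of 2] ..
  also have "\<dots> = hint (\<lambda>x. 2 * (phi x * ((Rt p p' x - (a + b * phi x) * u x) * q' A x (A x))))"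
    by (rule arg_cong[where f=hint], rule ext) (simp add: V_def L_def f'_def algebra_simps)
  finally show ?thesis .
qed

end

section \<open>The spherical Laplacian\<close>

definition rot :: "'a::euclidean_space \<Rightarrow> 'a \<Rightarrow> 'a \<Rightarrow> 'a" where
  "rot i j x = (x \<bullet> i) *\<^sub>R j - (x \<bullet> j) *\<^sub>R i"

lemma skew_rot: "skew (rot i j)"
  unfolding skew_def rot_def[abs_def]
  by (auto intro!: linearI simp: inner_diff_right inner_add_left algebra_simps inner_commute)

text \<open>With \<open>y = x / |x|\<close>, the difference of the two sides is the squared norm of
  \<open>M - trace M / 2 * (1 - y y\<^sup>T) - M y y\<^sup>T\<close>.\<close>
lemma matrix_trace_inequality:
  fixes x1 x2 x3 :: real
  assumes r: "x1\<^sup>2 + x2\<^sup>2 + x3\<^sup>2 > 0"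
    and w: "x1 * m11 + x2 * m21 + x3 * m31 = 0" "x1 * m12 + x2 * m22 + x3 * m32 = 0" "x1 * m13 + x2 * m23 + x3 * m33 = 0"
    and v: "(m11 * x1 + m12 * x2 + m13 * x3)\<^sup>2 + (m21 * x1 + m22 * x2 + m23 * x3)\<^sup>2 + (m31 * x1 + m32 * x2 + m33 * x3)\<^sup>2
      = (x1\<^sup>2 + x2\<^sup>2 + x3\<^sup>2) * Q"
  shows "(m11 + m22 + m33)\<^sup>2 / 2 + Q
    \<le> m11\<^sup>2 + m12\<^sup>2 + m13\<^sup>2 + m21\<^sup>2 + m22\<^sup>2 + m23\<^sup>2 + m31\<^sup>2 + m32\<^sup>2 + m33\<^sup>2"
proof -
  define R where "R = x1\<^sup>2 + x2\<^sup>2 + x3\<^sup>2"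
  define l where "l = (m11 + m22 + m33) / 2"
  define v1 v2 v3 where "v1 = m11 * x1 + m12 * x2 + m13 * x3" and "v2 = m21 * x1 + m22 * x2 + m23 * x3"
    and "v3 = m31 * x1 + m32 * x2 + m33 * x3"
  define S where "S = m11\<^sup>2 + m12\<^sup>2 + m13\<^sup>2 + m21\<^sup>2 + m22\<^sup>2 + m23\<^sup>2 + m31\<^sup>2 + m32\<^sup>2 + m33\<^sup>2"
  \<comment> \<open>The summands are the squared entries of one row of the matrix above, multiplied
    by \<open>R\<close>; \<open>a\<close> is the diagonal entry of that row and \<open>v\<close> the
    corresponding entry of \<open>M x\<close>.\<close>
  have row: "0 \<le> R\<^sup>2 * (a\<^sup>2 + b\<^sup>2 + c\<^sup>2) + l\<^sup>2 * (R\<^sup>2 - R * y1\<^sup>2) - R * v\<^sup>2 - 2 * R * l * (R * a - y1 * v)"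
    if y: "R = y1\<^sup>2 + y2\<^sup>2 + y3\<^sup>2" and v: "v = a * y1 + b * y2 + c * y3" for a b c v y1 y2 y3
  proof -
    have "(R * a - l * (R - y1\<^sup>2) - v * y1)\<^sup>2 + (R * b + l * y1 * y2 - v * y2)\<^sup>2 + (R * c + l * y1 * y3 - v * y3)\<^sup>2
      = R\<^sup>2 * (a\<^sup>2 + b\<^sup>2 + c\<^sup>2) + l\<^sup>2 * ((R - y1\<^sup>2)\<^sup>2 + y1\<^sup>2 * (y1\<^sup>2 + y2\<^sup>2 + y3\<^sup>2 - y1\<^sup>2)) + v\<^sup>2 * (y1\<^sup>2 + y2\<^sup>2 + y3\<^sup>2)
        - 2 * R * l * (R * a - y1 * (a * y1 + b * y2 + c * y3)) - 2 * R * v * (a * y1 + b * y2 + c * y3)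
        + 2 * l * v * y1 * (R - (y1\<^sup>2 + y2\<^sup>2 + y3\<^sup>2))"
      by (simp add: power2_eq_square algebra_simps)
    also have "\<dots> = R\<^sup>2 * (a\<^sup>2 + b\<^sup>2 + c\<^sup>2) + l\<^sup>2 * (R\<^sup>2 - R * y1\<^sup>2) - R * v\<^sup>2 - 2 * R * l * (R * a - y1 * v)"
      unfolding y[symmetric] v[symmetric] by (simp add: power2_eq_square algebra_simps)
    finally show ?thesis by (metis add_nonneg_nonneg zero_le_power2)
  qed
  have xv: "x1 * v1 + x2 * v2 + x3 * v3 = x1 * (x1 * m11 + x2 * m21 + x3 * m31)
      + x2 * (x1 * m12 + x2 * m22 + x3 * m32) + x3 * (x1 * m13 + x2 * m23 + x3 * m33)"
    unfolding v1_def v2_def v3_def by (simp add: algebra_simps)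
  have "0 \<le> R\<^sup>2 * S + l\<^sup>2 * (3 * R\<^sup>2 - R * (x1\<^sup>2 + x2\<^sup>2 + x3\<^sup>2)) - R * (v1\<^sup>2 + v2\<^sup>2 + v3\<^sup>2)
      - 2 * R * l * (R * (m11 + m22 + m33) - (x1 * v1 + x2 * v2 + x3 * v3))"
  proof -
    \<comment> \<open>Rows 2 and 3 are listed with their own index first, so that the diagonal entry
      takes the place of \<open>a\<close>.\<close>
    have y: "R = x1\<^sup>2 + x2\<^sup>2 + x3\<^sup>2" "R = x2\<^sup>2 + x1\<^sup>2 + x3\<^sup>2" "R = x3\<^sup>2 + x1\<^sup>2 + x2\<^sup>2"
      by (simp_all add: R_def)
    have v: "v1 = m11 * x1 + m12 * x2 + m13 * x3" "v2 = m22 * x2 + m21 * x1 + m23 * x3" "v3 = m33 * x3 + m31 * x1 + m32 * x2"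
      by (simp_all add: v1_def v2_def v3_def)
    show ?thesis
      using row[OF y(1) v(1)] row[OF y(2) v(2)] row[OF y(3) v(3)] by (simp add: S_def algebra_simps)
  qed
  also have "\<dots> = R\<^sup>2 * S - R\<^sup>2 * (2 * l\<^sup>2) - R * (v1\<^sup>2 + v2\<^sup>2 + v3\<^sup>2)"
    unfolding xv w R_def[symmetric] by (simp add: l_def power2_eq_square algebra_simps)
  finally have "0 \<le> R\<^sup>2 * S - R\<^sup>2 * (2 * l\<^sup>2) - R * (v1\<^sup>2 + v2\<^sup>2 + v3\<^sup>2)" .
  also have "v1\<^sup>2 + v2\<^sup>2 + v3\<^sup>2 = R * Q"
    using v by (simp add: v1_def v2_def v3_def R_def)
  finally have "0 \<le> R\<^sup>2 * (S - 2 * l\<^sup>2 - Q)" by (simp add: algebra_simps power2_eq_square)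
  moreover have "R > 0" using r by (simp add: R_def)
  ultimately have "0 \<le> S - 2 * l\<^sup>2 - Q" by (simp add: zero_le_mult_iff)
  then show ?thesis by (simp add: S_def l_def power_divide)
qed

context C2c_pball
begin

text \<open>Each coordinate plane occurs twice and \<open>rot i i\<close> is zero, hence the factor
  1/2, here and in \<open>Q\<close>. The latter is the squared length of the spherical
  gradient.\<close>

definition lam :: "'a \<Rightarrow> real" where
  "lam x = 1/2 * (\<Sum>i\<in>Basis. \<Sum>j\<in>Basis. q' (rot i j) x (rot i j x))"

definition Q :: "'a \<Rightarrow> real" where
  "Q x = 1/2 * (\<Sum>i\<in>Basis. \<Sum>j\<in>Basis. (q (rot i j) x)\<^sup>2)"

lemmas u_linear_simps =
  linear_0[OF u_linear(1)] linear_0[OF u_linear(2)] linear_0[OF u_linear(3)]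
  linear_add[OF u_linear(1)] linear_add[OF u_linear(2)] linear_add[OF u_linear(3)]
  linear_diff[OF u_linear(1)] linear_diff[OF u_linear(2)] linear_diff[OF u_linear(3)]
  linear_neg[OF u_linear(1)] linear_neg[OF u_linear(2)] linear_neg[OF u_linear(3)]
  linear_scale[OF u_linear(1)] linear_scale[OF u_linear(2)] linear_scale[OF u_linear(3)]

lemma u''_basis: "u'' x v w = (\<Sum>i\<in>Basis. \<Sum>j\<in>Basis. (v \<bullet> i) * (w \<bullet> j) * u'' x i j)"
proof -
  have "u'' x (\<Sum>i\<in>Basis. (v \<bullet> i) *\<^sub>R i) (\<Sum>j\<in>Basis. (w \<bullet> j) *\<^sub>R j)
      = (\<Sum>i\<in>Basis. \<Sum>j\<in>Basis. (v \<bullet> i) * (w \<bullet> j) * u'' x i j)"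
    unfolding linear_sum[OF u_linear(3)] linear_scale[OF u_linear(3)]
      linear_sum[OF u_linear(2)] linear_scale[OF u_linear(2)]
    by (subst sum.swap) (simp add: sum_distrib_left mult_ac)
  then show ?thesis by (simp add: euclidean_representation)
qed

lemma lam_eq:
  "lam x = (norm x)\<^sup>2 * (\<Sum>b\<in>Basis. u'' x b b) - u'' x x x - (real DIM('a) - 1) * u' x x"
proof -
  have r: "(\<Sum>b\<in>Basis. (x \<bullet> b) * (x \<bullet> b)) = (norm x)\<^sup>2"
    by (simp add: euclidean_inner[of x x] power2_norm_eq_inner flip: power2_eq_square)
  have ux: "u' x x = (\<Sum>j\<in>Basis. (x \<bullet> j) * u' x j)" by (rule C1c_deriv_basis[OF u_C1c])
  \<comment> \<open>Rotating twice sends \<open>x\<close> to minus its projection on the plane of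
    \<open>i\<close> and \<open>j\<close>, which gives the first-order terms; the conditional term
    restores the value 0 for \<open>i = j\<close>.\<close>
  have e: "q' (rot i j) x (rot i j x) = ((x \<bullet> i) * (x \<bullet> i)) * u'' x j j + ((x \<bullet> j) * (x \<bullet> j)) * u'' x i i
       - 2 * ((x \<bullet> i) * (x \<bullet> j) * u'' x i j)
       + (if i = j then 2 * ((x \<bullet> j) * u' x j) else 0) - (x \<bullet> j) * u' x j - (x \<bullet> i) * u' x i"
    if "i \<in> Basis" "j \<in> Basis" for i j
    unfolding q'_def rot_def
    using that C2c_symmetric[OF u, of x j i]
    by (simp add: u_linear_simps inner_diff_left inner_Basis algebra_simps)
  have "lam x = 1/2 * (\<Sum>i\<in>Basis. \<Sum>j\<in>Basis. ((x \<bullet> i) * (x \<bullet> i)) * u'' x j j + ((x \<bullet> j) * (x \<bullet> j)) * u'' x i i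
       - 2 * ((x \<bullet> i) * (x \<bullet> j) * u'' x i j)
       + (if i = j then 2 * ((x \<bullet> j) * u' x j) else 0) - (x \<bullet> j) * u' x j - (x \<bullet> i) * u' x i)"
    unfolding lam_def using e by simp
  also have "\<dots> = 1/2 * ((norm x)\<^sup>2 * (\<Sum>b\<in>Basis. u'' x b b) + (norm x)\<^sup>2 * (\<Sum>b\<in>Basis. u'' x b b) - 2 * u'' x x x
      + 2 * u' x x - real DIM('a) * u' x x - real DIM('a) * u' x x)"
  proof -
    have 1: "(\<Sum>i\<in>Basis. \<Sum>j\<in>Basis. ((x \<bullet> i) * (x \<bullet> i)) * u'' x j j) = (norm x)\<^sup>2 * (\<Sum>b\<in>Basis. u'' x b b)"
      unfolding r[symmetric] by (rule sum_product[symmetric])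
    have 2: "(\<Sum>i\<in>Basis. \<Sum>j\<in>Basis. ((x \<bullet> j) * (x \<bullet> j)) * u'' x i i) = (norm x)\<^sup>2 * (\<Sum>b\<in>Basis. u'' x b b)"
      by (subst sum.swap) (rule 1)
    have 3: "(\<Sum>i\<in>Basis. \<Sum>j\<in>Basis. 2 * ((x \<bullet> i) * (x \<bullet> j) * u'' x i j)) = 2 * u'' x x x"
      by (simp add: u''_basis[of x x x] sum_distrib_left)
    have 4: "(\<Sum>i\<in>Basis. \<Sum>j\<in>Basis. if i = j then 2 * ((x \<bullet> j) * u' x j) else 0) = 2 * u' x x"
      by (simp add: ux sum_distrib_left)
    have 5: "(\<Sum>i\<in>(Basis :: 'a set). \<Sum>j\<in>Basis. (x \<bullet> j) * u' x j) = real DIM('a) * u' x x"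
      by (simp add: ux)
    have 6: "(\<Sum>i\<in>Basis. \<Sum>j\<in>(Basis :: 'a set). (x \<bullet> i) * u' x i) = real DIM('a) * u' x x"
      by (simp add: ux sum_distrib_left)
    show ?thesis
      unfolding sum.distrib sum_subtractf 1 2 3 4 5 6 ..
  qed
  finally show ?thesis by (simp add: algebra_simps)
qed

lemma q'_Cc: "Cc K (\<lambda>x. q' (rot i j) x (rot k l x))"
  by (rule skew_Cc[OF q_C1c[OF skew_rot] skew_rot])

lemma lam_Cc: "Cc K lam"
  unfolding lam_def[abs_def] by (intro Cc_cmult Cc_sum q'_Cc)

lemma q_Cc: "Cc K (q (rot i j))"
  by (rule C1c_Cc[OF q_C1c[OF skew_rot]])

lemma Q_Cc: "Cc K Q"
  unfolding Q_def[abs_def] by (intro Cc_cmult Cc_sum Cc_power2 q_Cc)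

lemma Q_nonneg: "Q x \<ge> 0"
  by (auto simp: Q_def intro!: sum_nonneg)

text \<open>Let \<open>M\<close> be the matrix of second rotational derivatives, with trace
  \<open>lam\<close>. Integrating by parts shows that \<open>M\<close> and its trace have the same
  weighted square integral, while pointwise the squared norm of \<open>M\<close> is at least
  \<open>lam\<^sup>2 / 2 + Q\<close>. The constant 2 is the first nonzero eigenvalue of the
  2-sphere.\<close>

lemma sphere_spectral_gap:
  assumes "DIM('a) = 3"
  shows "2 * hint (\<lambda>x. (phi x)\<^sup>2 * Q x) \<le> hint (\<lambda>x. (phi x)\<^sup>2 * (lam x)\<^sup>2)"
proof -
  obtain e1 e2 e3 :: 'a where B: "Basis = {e1, e2, e3}" and ne: "e1 \<noteq> e2" "e1 \<noteq> e3" "e2 \<noteq> e3"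
    using assms by (metis card_3_iff)
  have inB: "e1 \<in> Basis" "e2 \<in> Basis" "e3 \<in> Basis" using B by auto
  have ip: "e1 \<bullet> e1 = 1" "e2 \<bullet> e2 = 1" "e3 \<bullet> e3 = 1" "e1 \<bullet> e2 = 0" "e1 \<bullet> e3 = 0" "e2 \<bullet> e3 = 0"
     "e2 \<bullet> e1 = 0" "e3 \<bullet> e1 = 0" "e3 \<bullet> e2 = 0"
    using inB ne by (auto simp: inner_Basis)
  define A1 A2 A3 where "A1 = rot e2 e3" and "A2 = rot e3 e1" and "A3 = rot e1 e2"
  have sk: "skew A1" "skew A2" "skew A3" by (auto simp: A1_def A2_def A3_def skew_rot)
  note Adef = A1_def A2_def A3_def rot_def
  define q1 q2 q3 where "q1 = q A1" and "q2 = q A2" and "q3 = q A3"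
  \<comment> \<open>\<open>m A B\<close> is \<open>A (B u)\<close>: the row index is the derivative
    taken last.\<close>
  define m where "m A B x = q' B x (A x)" for A B :: "'a \<Rightarrow> 'a" and x
  have sum3: "(\<Sum>i\<in>Basis. f i) = f e1 + f e2 + f e3" for f :: "'a \<Rightarrow> real"
    unfolding B using ne by simp
  have Q: "Q x = (q1 x)\<^sup>2 + (q2 x)\<^sup>2 + (q3 x)\<^sup>2" for x
    unfolding Q_def sum3 q1_def q2_def q3_def q_def Adef
    by (simp add: u_linear_simps power2_eq_square algebra_simps)
  have lam: "lam x = m A1 A1 x + m A2 A2 x + m A3 A3 x" for x
    unfolding lam_def sum3 m_def q'_def Adef
    by (simp add: u_linear_simps inner_diff_left ip algebra_simps)
  have comm: "m A1 A2 x = m A2 A1 x - q3 x" "m A2 A3 x = m A3 A2 x - q1 x" "m A3 A1 x = m A1 A3 x - q2 x" for x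
    unfolding q1_def q2_def q3_def m_def q'_def q_def
    by (auto simp: C2c_symmetric[OF u, of x "A1 x"] C2c_symmetric[OF u, of x "A2 x" "A3 x"])
       (auto simp: Adef u_linear_simps inner_diff_left ip algebra_simps)
  have brk: "l (A2 (A1 x)) - l (A1 (A2 x)) = (-1) * l (A3 x)" "l (A3 (A2 x)) - l (A2 (A3 x)) = (-1) * l (A1 x)"
    "l (A1 (A3 x)) - l (A3 (A1 x)) = (-1) * l (A2 x)" "l (A1 (A2 x)) - l (A2 (A1 x)) = 1 * l (A3 x)"
    "l (A2 (A3 x)) - l (A3 (A2 x)) = 1 * l (A1 x)" "l (A3 (A1 x)) - l (A1 (A3 x)) = 1 * l (A2 x)"
    if "linear l" for l :: "'a \<Rightarrow> real" and x
    unfolding Adef by (auto simp: linear_0[OF that] linear_add[OF that] linear_diff[OF that] linear_scale[OF that] inner_diff_left ip algebra_simps)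
  have mC: "Cc K (m A B)" if "skew A" "skew B" for A B
    unfolding m_def[abs_def] by (rule skew_Cc[OF q_C1c[OF that(2)] that(1)])
  have qC: "Cc K q1" "Cc K q2" "Cc K q3"
    unfolding q1_def q2_def q3_def by (auto intro: C1c_Cc q_C1c sk)
  have ql: "linear (q' A x)" if "skew A" for A x by (rule C1c_linear[OF q_C1c[OF that]])
  note R = radw_mult[OF radw_phi radw_phi, where 'a='a, folded power2_eq_square]
  note c = radw_continuous_K(1)[OF R]
  define F where "F A B C f s x = (phi x)\<^sup>2 * (m A A x * m B B x - m B A x * m A B x + s * (f x * m C B x))" for A B C f s x
  have FC: "Cc K (F A B C f s)" if "skew A" "skew B" "skew C" "Cc K f" for A B C f s
    unfolding F_def[abs_def] by (intro Cc_mult2 Cc_add Cc_diff Cc_prod Cc_cmult mC that c)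
  have F0: "hint (F A B C (q A) s) = 0" if "skew A" "skew B" "skew C"
    "\<And>x. q' B x (B (A x)) - q' B x (A (B x)) = s * q' B x (C x)" for A B C s
    using hint_swap_skew[OF q_C1c[OF that(1)] q_C1c[OF that(2)] R that(1,2)]
    unfolding F_def[abs_def] m_def that(4) by (simp add: mult.left_commute)
  have H: "hint (F A1 A2 A3 q1 (-1)) = 0" "hint (F A2 A1 A3 q2 1) = 0"
    "hint (F A2 A3 A1 q2 (-1)) = 0" "hint (F A3 A2 A1 q3 1) = 0"
    "hint (F A3 A1 A2 q3 (-1)) = 0" "hint (F A1 A3 A2 q1 1) = 0"
    unfolding q1_def q2_def q3_def
    by (intro F0 sk brk ql)+
  define N where "N x = (m A1 A1 x)\<^sup>2 + (m A1 A2 x)\<^sup>2 + (m A1 A3 x)\<^sup>2 + (m A2 A1 x)\<^sup>2 + (m A2 A2 x)\<^sup>2 + (m A2 A3 x)\<^sup>2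
    + (m A3 A1 x)\<^sup>2 + (m A3 A2 x)\<^sup>2 + (m A3 A3 x)\<^sup>2" for x
  have NC: "Cc K N" unfolding N_def[abs_def] by (intro Cc_add Cc_power2 mC sk)
  have C: "Cc K (\<lambda>x. (phi x)\<^sup>2 * N x)" "Cc K (\<lambda>x. (phi x)\<^sup>2 * (lam x)\<^sup>2)" "Cc K (\<lambda>x. (phi x)\<^sup>2 * Q x)"
    by (intro Cc_mult2 Cc_power2 NC lam_Cc Q_Cc c)+
  have "hint (\<lambda>x. (phi x)\<^sup>2 * (lam x)\<^sup>2) - hint (\<lambda>x. (phi x)\<^sup>2 * N x) = hint (\<lambda>x. (phi x)\<^sup>2 * (lam x)\<^sup>2 - (phi x)\<^sup>2 * N x)"
    by (rule hint_diff[OF C(2,1), symmetric])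
  \<comment> \<open>Pointwise identity: by the commutators,
    \<open>(m A1 A2 x - m A2 A1 x)\<^sup>2 = (q3 x)\<^sup>2\<close> and cyclically, and the
    commutator terms of the six functions \<open>F\<close> add up to minus the same squares.\<close>
  also have "\<dots> = hint (\<lambda>x. F A1 A2 A3 q1 (-1) x + F A2 A1 A3 q2 1 x + (F A2 A3 A1 q2 (-1) x + F A3 A2 A1 q3 1 x)
      + (F A3 A1 A2 q3 (-1) x + F A1 A3 A2 q1 1 x))"
    by (rule arg_cong[where f=hint], rule ext)
      (simp add: F_def lam N_def comm power2_eq_square algebra_simps)
  also have "\<dots> = 0"
    by (simp only: hint_add Cc_add FC sk qC H)
  finally have eq: "hint (\<lambda>x. (phi x)\<^sup>2 * N x) = hint (\<lambda>x. (phi x)\<^sup>2 * (lam x)\<^sup>2)" by simp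
  have pt: "(lam x)\<^sup>2 / 2 + Q x \<le> N x" if "x \<in> K" for x
  proof -
    define x1 x2 x3 where "x1 = x \<bullet> e1" and "x2 = x \<bullet> e2" and "x3 = x \<bullet> e3"
    have "x \<noteq> 0" using that K by auto
    then have r: "x1\<^sup>2 + x2\<^sup>2 + x3\<^sup>2 > 0"
      using euclidean_inner[of x x] unfolding sum3 by (simp add: x1_def x2_def x3_def power2_eq_square flip: inner_gt_zero_iff)
    show ?thesis
      unfolding lam N_def
    proof (rule matrix_trace_inequality[OF r])
      \<comment> \<open>The combination \<open>x1 A1 + x2 A2 + x3 A3\<close> of the fields is zero
        at \<open>x\<close>.\<close>
      show "x1 * m A1 A1 x + x2 * m A2 A1 x + x3 * m A3 A1 x = 0" "x1 * m A1 A2 x + x2 * m A2 A2 x + x3 * m A3 A2 x = 0"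
        "x1 * m A1 A3 x + x2 * m A2 A3 x + x3 * m A3 A3 x = 0"
        unfolding m_def Adef x1_def[symmetric] x2_def[symmetric] x3_def[symmetric]
        by (simp_all add: linear_diff[OF ql[OF skew_rot, unfolded rot_def[abs_def]]] linear_scale[OF ql[OF skew_rot, unfolded rot_def[abs_def]]] algebra_simps)
      \<comment> \<open>By the product rule the left sides come from \<open>A_i\<close> acting on
        the coefficients in \<open>x1 q1 + x2 q2 + x3 q3 = 0\<close>: up to sign, the cross product
        of \<open>x\<close> and \<open>(q1, q2, q3)\<close>.\<close>
      have v: "m A1 A1 x * x1 + m A1 A2 x * x2 + m A1 A3 x * x3 = x3 * q2 x - x2 * q3 x"
        "m A2 A1 x * x1 + m A2 A2 x * x2 + m A2 A3 x * x3 = x1 * q3 x - x3 * q1 x"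
        "m A3 A1 x * x1 + m A3 A2 x * x2 + m A3 A3 x * x3 = x2 * q1 x - x1 * q2 x"
        unfolding m_def q'_def q1_def q2_def q3_def q_def Adef x1_def[symmetric] x2_def[symmetric] x3_def[symmetric]
        by (simp_all add: u_linear_simps inner_diff_left ip algebra_simps)
      have o: "x1 * q1 x + x2 * q2 x + x3 * q3 x = 0"
        unfolding q1_def q2_def q3_def q_def Adef x1_def[symmetric] x2_def[symmetric] x3_def[symmetric]
        by (simp_all add: u_linear_simps algebra_simps)
      \<comment> \<open>Lagrange's identity for the cross product; the two vectors are orthogonal by
        \<open>o\<close>.\<close>
      have "(x3 * q2 x - x2 * q3 x)\<^sup>2 + (x1 * q3 x - x3 * q1 x)\<^sup>2 + (x2 * q1 x - x1 * q2 x)\<^sup>2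
        = (x1\<^sup>2 + x2\<^sup>2 + x3\<^sup>2) * Q x - (x1 * q1 x + x2 * q2 x + x3 * q3 x)\<^sup>2"
        unfolding Q by (simp add: power2_eq_square algebra_simps)
      then show "(m A1 A1 x * x1 + m A1 A2 x * x2 + m A1 A3 x * x3)\<^sup>2 + (m A2 A1 x * x1 + m A2 A2 x * x2 + m A2 A3 x * x3)\<^sup>2
         + (m A3 A1 x * x1 + m A3 A2 x * x2 + m A3 A3 x * x3)\<^sup>2 = (x1\<^sup>2 + x2\<^sup>2 + x3\<^sup>2) * Q x"
        unfolding v o by simp
    qed
  qed
  have "1/2 * hint (\<lambda>x. (phi x)\<^sup>2 * (lam x)\<^sup>2) + hint (\<lambda>x. (phi x)\<^sup>2 * Q x)
     = hint (\<lambda>x. 1/2 * ((phi x)\<^sup>2 * (lam x)\<^sup>2) + (phi x)\<^sup>2 * Q x)"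
    unfolding hint_add[OF Cc_cmult[OF C(2)] C(3)] hint_cmult ..
  also have "\<dots> \<le> hint (\<lambda>x. (phi x)\<^sup>2 * N x)"
  proof (rule hint_mono[OF Cc_add[OF Cc_cmult[OF C(2)] C(3)] C(1)])
    show "1/2 * ((phi x)\<^sup>2 * (lam x)\<^sup>2) + (phi x)\<^sup>2 * Q x \<le> (phi x)\<^sup>2 * N x" if "x \<in> K" for x
      using mult_left_mono[OF pt[OF that], of "(phi x)\<^sup>2"] by (simp add: algebra_simps)
  qed
  finally show ?thesis unfolding eq by simp
qed

end

section \<open>The Laplace--Beltrami operator\<close>

lemma pdir_eq:
  assumes "(f has_derivative f') (at x)"
  shows "pdir f e x = f' e"
proof -
  have l: "((\<lambda>s. x + s *\<^sub>R e) has_derivative (\<lambda>s. s *\<^sub>R e)) (at 0)"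
    by (auto intro!: derivative_eq_intros)
  have "(f has_derivative f') (at (x + 0 *\<^sub>R e))" using assms by simp
  from has_derivative_compose[OF l this]
  have "((\<lambda>s. f (x + s *\<^sub>R e)) has_derivative (\<lambda>s. f' (s *\<^sub>R e))) (at 0)" .
  moreover have "(\<lambda>s. f' (s *\<^sub>R e)) = (*) (f' e)"
    using has_derivative_linear[OF assms] by (auto simp: linear_scale)
  ultimately have "((\<lambda>s. f (x + s *\<^sub>R e)) has_field_derivative f' e) (at 0)"
    by (simp add: has_field_derivative_def)
  then show ?thesis unfolding pdir_def by (rule DERIV_imp_deriv)
qed

lemma arg_le_sinh: "0 \<le> t \<Longrightarrow> t \<le> sinh t" for t :: real
  using real_le_x_sinh[of t] by (simp add: sinh_def exp_minus)

lemma phi_le_inverse_hrho: "x \<in> pball \<Longrightarrow> phi x \<le> 1 / (hrho x)\<^sup>2"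
  unfolding phi_def using hrho_pos[of x] arg_le_sinh[of "hrho x"]
  by (intro divide_left_mono power_mono) auto

context C2c_pball
begin

lemma hyp_laplacian_off: "x \<notin> K \<Longrightarrow> hyp_laplacian u x = 0"
proof -
  assume x: "x \<notin> K"
  have "pdir (\<lambda>y. conf y ^ DIM('a) * inverse ((conf y)\<^sup>2) * pdir u b y) b x = 0" for b
  proof -
    have "((\<lambda>y. conf y ^ DIM('a) * inverse ((conf y)\<^sup>2) * pdir u b y) has_derivative (\<lambda>_. 0)) (at x)"
    proof (rule has_derivative_transform_within_open[where s="-K"])
      show "((\<lambda>y. 0) has_derivative (\<lambda>_. 0)) (at x)" by simp
      show "open (-K)" using K by (simp add: compact_imp_closed open_Compl)
      show "0 = conf y ^ DIM('a) * inverse ((conf y)\<^sup>2) * pdir u b y" if "y \<in> -K" for y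
        using that u_C1c by (simp add: pdir_eq[OF C1c_has_derivative[OF u_C1c]] C1c_def)
    qed (use x in simp)
    from pdir_eq[OF this] show ?thesis by simp
  qed
  then show ?thesis by (simp add: hyp_laplacian_def)
qed

text \<open>The zeroth-order terms of \<open>Rt_p\<close> cancel the potential, and
  \<open>lam_eq\<close> trades the second radial derivative for the Euclidean Laplacian. The
  first-order terms then match because
  \<open>coth \<rho> / sinh \<rho> = phi + 1 / conf\<close>.\<close>

lemma hyp_laplacian_eq:
  assumes x: "x \<in> pball" and n: "DIM('a) \<ge> 2"
  shows "hyp_laplacian u x = Rt p p' x - ((real DIM('a) - 1)\<^sup>2 / 4 + (real DIM('a) - 1) * (real DIM('a) - 3) / 4 * phi x) * u x + phi x * lam x"
proof -
  \<comment> \<open>The weight inside the divergence is \<open>conf ^ (n - 2)\<close>; naming the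
    exponent keeps the natural subtraction exact.\<close>
  define k where "k = DIM('a) - 2"
  have k: "DIM('a) = k + 2" "real k = real DIM('a) - 2" using n by (auto simp: k_def)
  define c r where "c = conf x" and "r = norm x"
  have pos: "c > 0" "r > 0" using conf_pos[OF x] pball_norm[OF x] by (auto simp: c_def r_def)
  have pd: "pdir (\<lambda>y. conf y ^ DIM('a) * inverse ((conf y)\<^sup>2) * pdir u b y) b x = c ^ k * u'' x b b + real k * c ^ k * c * ((x \<bullet> b) * u' x b)" for b
  proof -
    have "((\<lambda>y. conf y ^ k) has_derivative (\<lambda>v. real k * conf x ^ k * norm x * (conf x / norm x) * (x \<bullet> v))) (at x)"
      using radw_conf_power[of k] x unfolding radw_def by blast
    moreover have "((\<lambda>y. u' y b) has_derivative u'' x b) (at x)"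
      using u by (simp add: C2c_def C1c_def)
    ultimately have "((\<lambda>y. conf y ^ k * u' y b) has_derivative
       (\<lambda>v. conf x ^ k * u'' x b v + real k * conf x ^ k * norm x * (conf x / norm x) * (x \<bullet> v) * u' x b)) (at x)"
      by (rule has_derivative_mult)
    then have "((\<lambda>y. conf y ^ DIM('a) * inverse ((conf y)\<^sup>2) * pdir u b y) has_derivative
       (\<lambda>v. conf x ^ k * u'' x b v + real k * conf x ^ k * norm x * (conf x / norm x) * (x \<bullet> v) * u' x b)) (at x)"
    proof (rule has_derivative_transform_within_open[OF _ open_pball x])
      show "conf y ^ k * u' y b = conf y ^ DIM('a) * inverse ((conf y)\<^sup>2) * pdir u b y" if "y \<in> pball" for y
        using conf_pos[OF that] by (simp add: pdir_eq[OF C1c_has_derivative[OF u_C1c]] k(1) power_add divide_simps power2_eq_square)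
    qed
    from pdir_eq[OF this, of b] show ?thesis using pos by (simp add: c_def r_def)
  qed
  have ux: "(\<Sum>b\<in>Basis. (x \<bullet> b) * u' x b) = u' x x" by (rule C1c_deriv_basis[OF u_C1c, symmetric])
  have "hyp_laplacian u x = inverse (c ^ DIM('a)) * (c ^ k * (\<Sum>b\<in>Basis. u'' x b b) + real k * c ^ k * c * u' x x)"
    unfolding hyp_laplacian_def pd ux[symmetric] by (simp add: sum.distrib sum_distrib_left c_def)
  also have "\<dots> = 1 / c\<^sup>2 * (\<Sum>b\<in>Basis. u'' x b b) + real k * (1 / c) * u' x x"
    unfolding k(1) using pos by (simp add: power_add field_simps power2_eq_square)
  finally have L: "hyp_laplacian u x = \<dots>" .
  have s: "sinh (hrho x) = c * r" by (simp add: sinh_hrho[OF x] c_def r_def)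
  have ph: "phi x = 1 / (c\<^sup>2 * r\<^sup>2)" by (simp add: phi_def s power_mult_distrib)
  have "inverse r + c * r = c * coth_rho x" using conf_coth_identity[OF x] by (simp add: c_def r_def)
  then have "coth_rho x = (inverse r + c * r) / c" using pos by (simp add: field_simps)
  then have ct: "coth_rho x / sinh (hrho x) = 1 / (c\<^sup>2 * r\<^sup>2) + 1 / c"
    unfolding s using pos by (simp add: field_simps power2_eq_square)
  have R: "phi x * (norm x)\<^sup>2 = 1 / c\<^sup>2" unfolding ph r_def[symmetric] using pos by simp
  have "Rt p p' x - ((real DIM('a) - 1)\<^sup>2 / 4 + (real DIM('a) - 1) * (real DIM('a) - 3) / 4 * phi x) * u x + phi x * lam x
     = phi x * (u'' x x x + u' x x) + (real DIM('a) - 2) * (coth_rho x / sinh (hrho x)) * u' x x + phi x * lam x"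
    unfolding Rt_p[OF x] by simp
  also have "\<dots> = (phi x * (norm x)\<^sup>2) * (\<Sum>b\<in>Basis. u'' x b b) + (real DIM('a) - 2) * (coth_rho x / sinh (hrho x) - phi x) * u' x x"
    unfolding lam_eq by (simp add: algebra_simps)
  also have "\<dots> = hyp_laplacian u x"
    unfolding L R ct k(2) by (simp add: ph)
  finally show ?thesis ..
qed

lemma hnorm2_eq_hint:
  assumes "\<And>x. x \<notin> K \<Longrightarrow> f x = 0"
  shows "hnorm2 f = hint (\<lambda>x. (f x)\<^sup>2)"
  unfolding hnorm2_def hint_def set_lebesgue_integral_def
proof (rule Bochner_Integration.integral_cong[OF refl])
  show "indicator (ball 0 1) x *\<^sub>R ((f x)\<^sup>2 * conf x ^ DIM('a)) = (f x)\<^sup>2 * conf x ^ DIM('a)" for x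
    using assms[of x] K by (cases "x \<in> K") (auto simp: indicator_def)
qed

lemma hnorm2_laplacian_ge:
  assumes n: "DIM('a) \<ge> 3"
  defines "a \<equiv> (real DIM('a) - 1)\<^sup>2 / 4" and "b \<equiv> (real DIM('a) - 1) * (real DIM('a) - 3) / 4"
  shows "hint (\<lambda>x. (a\<^sup>2 + a / 2 * (1 / (hrho x)\<^sup>2) + 9/16 * (1 / hrho x ^ 4) + (b\<^sup>2 - 2 * b) * (phi x)\<^sup>2
      + (2 * a * b - 2 * b) * phi x + b / 2 * (phi x * (1 / (hrho x)\<^sup>2))) * (u x)\<^sup>2)
    \<le> hnorm2 (hyp_laplacian u)"
proof -
  define G where "G x = Rt p p' x - (a + b * phi x) * u x" for x
  define W where "W x = (2 * a - 2) * phi x + (2 * b - 2) * (phi x)\<^sup>2 + 1/2 * (phi x * (1 / (hrho x)\<^sup>2))" for x :: 'a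
  have Wc: "continuous_on K W" unfolding W_def[abs_def]
    by (intro continuous_on_add continuous_on_mult continuous_on_power continuous_on_const phi_continuous inverse_hrho_continuous)
  have GC: "Cc K G" unfolding G_def[abs_def] 
    by (intro Cc_diff Cc_mult2 u_Cc continuous_on_add continuous_on_mult continuous_on_const phi_continuous)
  have rn: "real DIM('a) \<ge> 3" using n by simp
  have "(2::real)\<^sup>2 \<le> (real DIM('a) - 1)\<^sup>2" using rn by (intro power_mono) auto
  then have a: "a \<ge> 1" by (simp add: a_def)
  have b: "b \<ge> 0" using rn by (simp add: b_def)
  have C: "Cc K (\<lambda>x. (G x)\<^sup>2)" "Cc K (\<lambda>x. 2 * (phi x * (G x * lam x)))" "Cc K (\<lambda>x. (phi x)\<^sup>2 * (lam x)\<^sup>2)"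
     "Cc K (\<lambda>x. (phi x)\<^sup>2 * Q x)" "Cc K (\<lambda>x. W x * Q x)"
    by (intro Cc_cmult Cc_mult2 Cc_prod Cc_power2 GC lam_Cc Q_Cc Wc phi_continuous continuous_on_power)+
  have lap: "hyp_laplacian u x = G x + phi x * lam x" for x
  proof (cases "x \<in> K")
    case True
    then have "x \<in> pball" using K by blast
    then show ?thesis using hyp_laplacian_eq[of x] n by (simp add: G_def a_def b_def)
  next
    case False
    then show ?thesis using hyp_laplacian_off[OF False] GC lam_Cc by (simp add: Cc_def)
  qed
  have "hnorm2 (hyp_laplacian u) = hint (\<lambda>x. (hyp_laplacian u x)\<^sup>2)"
    by (rule hnorm2_eq_hint[OF hyp_laplacian_off])
  also have "\<dots> = hint (\<lambda>x. (G x)\<^sup>2 + 2 * (phi x * (G x * lam x)) + (phi x)\<^sup>2 * (lam x)\<^sup>2)"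
    by (rule arg_cong[where f=hint], rule ext) (simp add: lap power2_eq_square algebra_simps)
  also have "\<dots> = hint (\<lambda>x. (G x)\<^sup>2) + hint (\<lambda>x. 2 * (phi x * (G x * lam x))) + hint (\<lambda>x. (phi x)\<^sup>2 * (lam x)\<^sup>2)"
    by (simp only: hint_add Cc_add C)
  finally have eq: "hnorm2 (hyp_laplacian u) = \<dots>" .
  \<comment> \<open>The cross inequality is summed over all rotation fields; \<open>W\<close> is the
    weight that it leaves on the spherical gradient.\<close>
  have "hint (\<lambda>x. W x * Q x) = hint (\<lambda>x. 1/2 * (\<Sum>i\<in>Basis. \<Sum>j\<in>Basis. W x * (q (rot i j) x)\<^sup>2))"
    by (simp add: Q_def sum_distrib_left mult_ac)
  also have "\<dots> = 1/2 * (\<Sum>i\<in>Basis. \<Sum>j\<in>Basis. hint (\<lambda>x. W x * (q (rot i j) x)\<^sup>2))"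
  proof -
    have "Cc K (\<lambda>x. W x * (q (rot i j) x)\<^sup>2)" for i j by (intro Cc_mult2 Cc_power2 q_Cc Wc)
    then show ?thesis unfolding hint_cmult by (simp add: hint_sum Cc_sum)
  qed
  also have "\<dots> \<le> 1/2 * (\<Sum>i\<in>Basis. \<Sum>j\<in>Basis. hint (\<lambda>x. 2 * (phi x * (G x * q' (rot i j) x (rot i j x)))))"
    unfolding W_def G_def by (intro mult_left_mono sum_mono cross_inequality skew_rot) simp
  also have "\<dots> = hint (\<lambda>x. 1/2 * (\<Sum>i\<in>Basis. \<Sum>j\<in>Basis. 2 * (phi x * (G x * q' (rot i j) x (rot i j x)))))"
  proof -
    have "Cc K (\<lambda>x. 2 * (phi x * (G x * q' (rot i j) x (rot i j x))))" for i j
      by (intro Cc_cmult Cc_mult2 Cc_prod q'_Cc GC phi_continuous)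
    then show ?thesis unfolding hint_cmult[of "1/2"] by (simp only: hint_sum Cc_sum)
  qed
  also have "\<dots> = hint (\<lambda>x. 2 * (phi x * (G x * lam x)))"
    by (rule arg_cong[where f=hint], rule ext) (simp add: lam_def sum_distrib_left mult_ac)
  finally have cross: "hint (\<lambda>x. W x * Q x) \<le> hint (\<lambda>x. 2 * (phi x * (G x * lam x)))" .
  have pl: "phi x * phi x \<le> phi x * (1 / (hrho x)\<^sup>2)" if "x \<in> K" for x
  proof (rule mult_left_mono[OF phi_le_inverse_hrho phi_nonneg])
    show "x \<in> pball" using that K by blast
  qed
  have "0 \<le> hint (\<lambda>x. W x * Q x) + hint (\<lambda>x. (phi x)\<^sup>2 * (lam x)\<^sup>2)"
  \<comment> \<open>In dimension 3, \<open>b = 0\<close> puts \<open>- 2 (phi x)\<^sup>2\<close>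
    into \<open>W\<close>, which the term \<open>1/2 * (phi x / \<rho>\<^sup>2)\<close> cannot
    absorb near the origin; the gap constant 2 cancels it exactly.\<close>
  proof (cases "DIM('a) = 3")
    case True
    then have b0: "b = 0" by (simp add: b_def)
    have "0 \<le> hint (\<lambda>x. W x * Q x + 2 * ((phi x)\<^sup>2 * Q x))"
    proof (rule hint_nonneg[OF Cc_add[OF C(5) Cc_cmult[OF C(4)]]])
      fix x assume x: "x \<in> K"
      have "W x * Q x + 2 * ((phi x)\<^sup>2 * Q x) = ((2 * a - 2) * phi x + 1/2 * (phi x * (1 / (hrho x)\<^sup>2))) * Q x"
        by (simp add: W_def b0 algebra_simps)
      also have "\<dots> \<ge> 0"
        using a phi_nonneg[of x] Q_nonneg[of x] by (intro mult_nonneg_nonneg add_nonneg_nonneg) auto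
      finally show "0 \<le> W x * Q x + 2 * ((phi x)\<^sup>2 * Q x)" .
    qed
    also have "\<dots> = hint (\<lambda>x. W x * Q x) + 2 * hint (\<lambda>x. (phi x)\<^sup>2 * Q x)"
      unfolding hint_add[OF C(5) Cc_cmult[OF C(4)]] hint_cmult ..
    finally show ?thesis using sphere_spectral_gap[OF True] by simp
  next
    case False
    then have "real DIM('a) \<ge> 4" using n by simp
    then have "3 * 1 \<le> (real DIM('a) - 1) * (real DIM('a) - 3)" by (intro mult_mono) auto
    \<comment> \<open>Dimension 4 is the borderline: there \<open>2 b - 2 = - 1/2\<close>, exactly
      what half of \<open>phi x * phi x \<le> phi x * (1 / (hrho x)\<^sup>2)\<close>
      compensates.\<close>
    then have b: "b \<ge> 3/4" by (simp add: b_def)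
    have "0 \<le> hint (\<lambda>x. W x * Q x)"
    proof (rule hint_nonneg[OF C(5)])
      fix x assume x: "x \<in> K"
      have "0 \<le> (2 * a - 2) * phi x + (2 * b - 3/2) * (phi x * phi x)"
        using a b phi_nonneg[of x] by (intro add_nonneg_nonneg mult_nonneg_nonneg) auto
      also have "\<dots> \<le> W x"
        using pl[OF x] by (simp add: W_def power2_eq_square algebra_simps)
      finally show "0 \<le> W x * Q x" using Q_nonneg by simp
    qed
    moreover have "0 \<le> hint (\<lambda>x. (phi x)\<^sup>2 * (lam x)\<^sup>2)"
      by (rule hint_nonneg[OF C(3)]) simp
    ultimately show ?thesis by simp
  qed
  then show ?thesis
    using radial_inequality[of a b] a b cross unfolding eq G_def by simp
qed

end

section \<open>From the hypothesis on \<open>u\<close> to globally defined derivatives\<close>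

lemma C1c_extend:
  assumes K: "closed K" "K \<subseteq> S" "open S"
    and d: "\<And>x. x \<in> S \<Longrightarrow> (f has_derivative g x) (at x)"
    and c: "\<And>v. continuous_on S (\<lambda>x. g x v)" and z: "\<And>x. x \<notin> K \<Longrightarrow> f x = 0"
  shows "C1c K f (\<lambda>x v. if x \<in> K then g x v else 0)"
    and "x \<in> S - K \<Longrightarrow> g x v = 0"
proof -
  have d0: "(f has_derivative (\<lambda>_. 0)) (at x)" if "x \<notin> K" for x
    by (rule has_derivative_transform_within_open[where s="-K" and f="\<lambda>_. 0"]) (use that K z in auto)
  \<comment> \<open>On the open set \<open>S - K\<close> the function is locally zero, so uniqueness
    of derivatives forces \<open>g\<close> to vanish there; cutting \<open>g\<close> off at
    \<open>K\<close> therefore keeps it continuous.\<close>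
  have g0: "g x = (\<lambda>_. 0)" if "x \<in> S - K" for x
    using that by (intro has_derivative_unique[OF d d0]) auto
  then show "x \<in> S - K \<Longrightarrow> g x v = 0" by (simp add: fun_eq_iff)
  have gi: "(if x \<in> K then g x v else 0) = (if x \<in> S then g x v else 0)" for x v
    using g0[of x] K by auto
  show "C1c K f (\<lambda>x v. if x \<in> K then g x v else 0)"
    unfolding C1c_def
  proof (intro conjI allI impI)
    show "(f has_derivative (\<lambda>v. if x \<in> K then g x v else 0)) (at x)" for x
      using d[of x] d0[of x] K by (cases "x \<in> K") auto
    show "continuous_on UNIV (\<lambda>x. if x \<in> K then g x v else 0)" for v
    proof -
      have "continuous_on S (\<lambda>x. if x \<in> K then g x v else 0)"
        unfolding gi by (rule continuous_on_eq[OF c]) auto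
      moreover have "continuous_on (-K) (\<lambda>x. if x \<in> K then g x v else 0)"
        by (rule continuous_on_eq[where f="\<lambda>_. 0"]) auto
      ultimately have "continuous_on (S \<union> -K) (\<lambda>x. if x \<in> K then g x v else 0)"
        using K by (intro continuous_on_open_Un) auto
      moreover have "S \<union> -K = UNIV" using K by auto
      ultimately show ?thesis by simp
    qed
  qed (use z in auto)
qed

lemma C2c_punct_imp_C2c_pball:
  fixes u :: "'a::euclidean_space \<Rightarrow> real"
  assumes "C2c_punct u"
  shows "\<exists>K u' u''. C2c_pball K u u' u''"
proof -
  define K where "K = closure {x. u x \<noteq> 0}"
  obtain D :: "'a \<Rightarrow> 'a \<Rightarrow>\<^sub>L real" and D2 where D: "\<And>x. x \<in> pball \<Longrightarrow> (u has_derivative blinfun_apply (D x)) (at x)"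
    "\<And>x. x \<in> pball \<Longrightarrow> (D has_derivative blinfun_apply (D2 x)) (at x)" "continuous_on pball D2"
    and K: "compact K" "K \<subseteq> pball"
    using assms unfolding C2c_punct_def C2_on_def K_def by blast
  have z: "u x = 0" if "x \<notin> K" for x
    using that closure_subset[of "{x. u x \<noteq> 0}"] unfolding K_def by blast
  have cl: "closed K" using K by (simp add: compact_imp_closed)
  have Dc: "continuous_on pball D"
    using D(2) by (meson has_derivative_continuous continuous_at_imp_continuous_on)
  define u' where "u' x v = (if x \<in> K then blinfun_apply (D x) v else 0)" for x v
  \<comment> \<open>The slots are exchanged: \<open>D2 x\<close> takes the later direction
    \<open>w\<close> first, while \<open>u''\<close> lists the earlier direction \<open>v\<close>
    first.\<close>
  define u'' where "u'' x v w = (if x \<in> K then blinfun_apply (blinfun_apply (D2 x) w) v else 0)" for x v w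
  have c1: "continuous_on pball (\<lambda>x. blinfun_apply (D x) v)" for v
    by (intro continuous_intros Dc)
  note e = C1c_extend[OF cl K(2) open_pball D(1) c1 z]
  have u_C1c: "C1c K u u'" using e(1) by (simp add: u'_def[abs_def])
  have u2: "C1c K (\<lambda>x. u' x v) (\<lambda>x. u'' x v)" for v
  proof -
    have "C1c K (\<lambda>x. u' x v) (\<lambda>x w. if x \<in> K then blinfun_apply (blinfun_apply (D2 x) w) v else 0)"
    proof (rule C1c_extend(1)[OF cl K(2) open_pball])
      fix x :: 'a assume x: "x \<in> pball"
      have "((\<lambda>x. blinfun_apply (D x) v) has_derivative (\<lambda>w. blinfun_apply (blinfun_apply (D2 x) w) v)) (at x)"
        using blinfun.FDERIV[OF D(2)[OF x] has_derivative_const[of v]] by simp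
      then show "((\<lambda>x. u' x v) has_derivative (\<lambda>w. blinfun_apply (blinfun_apply (D2 x) w) v)) (at x)"
        by (rule has_derivative_transform_within_open[OF _ open_pball x]) (use e(2) in \<open>auto simp: u'_def\<close>)
    next
      show "continuous_on pball (\<lambda>x. blinfun_apply (blinfun_apply (D2 x) w) v)" for w
        by (intro continuous_intros D(3))
    qed (simp add: u'_def)
    then show ?thesis by (simp add: u''_def[abs_def])
  qed
  have "C2c_pball K u u' u''"
    by unfold_locales (use K u_C1c u2 in \<open>auto simp: C2c_def\<close>)
  then show ?thesis by blast
qed

section \<open>The explicit coefficients and the dimensions three and four\<close>

lemma hyperbolic_rellich:
  fixes u :: "'a::euclidean_space \<Rightarrow> real"
  assumes "DIM('a) \<ge> 3" and "C2c_punct u"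
  shows "hnorm2 (hyp_laplacian u) \<ge>
      (real DIM('a) - 1) ^ 4 / 16 * hnorm2 u
    + (real DIM('a) - 1)\<^sup>2 / 8 * hnorm2 (\<lambda>x. u x / hrho x)
    + 9 / 16 * hnorm2 (\<lambda>x. u x / (hrho x)\<^sup>2)
    + ((real DIM('a))\<^sup>2 - 1) * (real DIM('a) - 3) * (real DIM('a) - 5) / 16
        * hnorm2 (\<lambda>x. u x / (sinh (hrho x))\<^sup>2)
    + ((real DIM('a))\<^sup>2 - 1) * (real DIM('a) - 3)\<^sup>2 / 8 * hnorm2 (\<lambda>x. u x / sinh (hrho x))
    + (real DIM('a) - 1) * (real DIM('a) - 3) / 8 * hnorm2 (\<lambda>x. u x / (hrho x * sinh (hrho x)))"
proof -
  obtain K u' u'' where "C2c_pball K u u' u''" using C2c_punct_imp_C2c_pball[OF assms(2)] by blast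
  then interpret C2c_pball K u u' u'' .
  define n where "n = real DIM('a)"
  define a b where "a = (n - 1)\<^sup>2 / 4" and "b = (n - 1) * (n - 3) / 4"
  have off: "u x = 0" if "x \<notin> K" for x using u_C1c that by (simp add: C1c_def)
  have h: "hnorm2 (\<lambda>x. u x / w x) = hint (\<lambda>x. (1 / w x)\<^sup>2 * (u x)\<^sup>2)" for w
    using hnorm2_eq_hint[of "\<lambda>x. u x / w x"] off by (simp add: power_divide)
  have N: "hnorm2 u = hint (\<lambda>x. (u x)\<^sup>2)"
    "hnorm2 (\<lambda>x. u x / hrho x) = hint (\<lambda>x. 1 / (hrho x)\<^sup>2 * (u x)\<^sup>2)"
    "hnorm2 (\<lambda>x. u x / (hrho x)\<^sup>2) = hint (\<lambda>x. 1 / hrho x ^ 4 * (u x)\<^sup>2)"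
    "hnorm2 (\<lambda>x. u x / (sinh (hrho x))\<^sup>2) = hint (\<lambda>x. (phi x)\<^sup>2 * (u x)\<^sup>2)"
    "hnorm2 (\<lambda>x. u x / sinh (hrho x)) = hint (\<lambda>x. phi x * (u x)\<^sup>2)"
    "hnorm2 (\<lambda>x. u x / (hrho x * sinh (hrho x))) = hint (\<lambda>x. (phi x * (1 / (hrho x)\<^sup>2)) * (u x)\<^sup>2)"
    using hnorm2_eq_hint[of u] off
    by (simp_all add: h phi_def power_divide power_mult_distrib mult.commute flip: power_mult)
  have C: "Cc K (\<lambda>x. w x * (u x)\<^sup>2)" if "continuous_on K w" for w
    by (intro Cc_mult2 Cc_power2 u_Cc that)
  have c: "Cc K (\<lambda>x. (u x)\<^sup>2)" "Cc K (\<lambda>x. 1 / (hrho x)\<^sup>2 * (u x)\<^sup>2)" "Cc K (\<lambda>x. 1 / hrho x ^ 4 * (u x)\<^sup>2)"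
    "Cc K (\<lambda>x. (phi x)\<^sup>2 * (u x)\<^sup>2)" "Cc K (\<lambda>x. phi x * (u x)\<^sup>2)" "Cc K (\<lambda>x. (phi x * (1 / (hrho x)\<^sup>2)) * (u x)\<^sup>2)"
    by (intro C Cc_power2 u_Cc phi_continuous inverse_hrho_continuous continuous_on_mult continuous_on_power)+
  have "hint (\<lambda>x. (a\<^sup>2 + a / 2 * (1 / (hrho x)\<^sup>2) + 9/16 * (1 / hrho x ^ 4) + (b\<^sup>2 - 2 * b) * (phi x)\<^sup>2
      + (2 * a * b - 2 * b) * phi x + b / 2 * (phi x * (1 / (hrho x)\<^sup>2))) * (u x)\<^sup>2)
    = hint (\<lambda>x. a\<^sup>2 * (u x)\<^sup>2 + a / 2 * (1 / (hrho x)\<^sup>2 * (u x)\<^sup>2) + 9/16 * (1 / hrho x ^ 4 * (u x)\<^sup>2)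
      + (b\<^sup>2 - 2 * b) * ((phi x)\<^sup>2 * (u x)\<^sup>2) + (2 * a * b - 2 * b) * (phi x * (u x)\<^sup>2)
      + b / 2 * ((phi x * (1 / (hrho x)\<^sup>2)) * (u x)\<^sup>2))"
    by (rule arg_cong[where f=hint], rule ext) (simp add: algebra_simps)
  also have "\<dots> = a\<^sup>2 * hnorm2 u + a / 2 * hnorm2 (\<lambda>x. u x / hrho x) + 9/16 * hnorm2 (\<lambda>x. u x / (hrho x)\<^sup>2)
      + (b\<^sup>2 - 2 * b) * hnorm2 (\<lambda>x. u x / (sinh (hrho x))\<^sup>2) + (2 * a * b - 2 * b) * hnorm2 (\<lambda>x. u x / sinh (hrho x))
      + b / 2 * hnorm2 (\<lambda>x. u x / (hrho x * sinh (hrho x)))"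
    unfolding N by (simp only: hint_add Cc_add Cc_cmult c hint_cmult)
  finally have "\<dots> \<le> hnorm2 (hyp_laplacian u)"
    using hnorm2_laplacian_ge[OF assms(1)] unfolding a_def b_def n_def by simp
  \<comment> \<open>The factorizations come from \<open>b - 2 = (n + 1) (n - 5) / 4\<close> and
    \<open>a - 1 = (n + 1) (n - 3) / 4\<close>.\<close>
  moreover have "a\<^sup>2 = (n - 1) ^ 4 / 16" "a / 2 = (n - 1)\<^sup>2 / 8"
    "b\<^sup>2 - 2 * b = (n\<^sup>2 - 1) * (n - 3) * (n - 5) / 16" "2 * a * b - 2 * b = (n\<^sup>2 - 1) * (n - 3)\<^sup>2 / 8"
    "b / 2 = (n - 1) * (n - 3) / 8"
    by (simp_all add: a_def b_def power_divide power2_eq_square field_simps power4_eq_xxxx)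
  ultimately show ?thesis by (simp only: n_def)
qed

text \<open>For dimension 4, where the coefficient of \<open>u / sinh\<^sup>2 \<rho>\<close> is
  \<open>- 15/16\<close>: since \<open>\<rho> \<le> sinh \<rho>\<close>, the two positive terms with
  coefficients \<open>9/16\<close> and \<open>3/8\<close> absorb it exactly.\<close>

lemma hnorm2_sinh_square_le:
  fixes u :: "'a::euclidean_space \<Rightarrow> real"
  assumes "C2c_punct u"
  shows "hnorm2 (\<lambda>x. u x / (sinh (hrho x))\<^sup>2) \<le> hnorm2 (\<lambda>x. u x / (hrho x)\<^sup>2)"
    and "hnorm2 (\<lambda>x. u x / (sinh (hrho x))\<^sup>2) \<le> hnorm2 (\<lambda>x. u x / (hrho x * sinh (hrho x)))"
proof -
  obtain K u' u'' where "C2c_pball K u u' u''" using C2c_punct_imp_C2c_pball[OF assms] by blast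
  then interpret C2c_pball K u u' u'' .
  have off: "u x = 0" if "x \<notin> K" for x using u_C1c that by (simp add: C1c_def)
  have mono: "hnorm2 (\<lambda>x. u x / w x) \<le> hnorm2 (\<lambda>x. u x / v x)"
    if "continuous_on K w" "continuous_on K v" and vw0: "\<And>x. x \<in> pball \<Longrightarrow> 0 < v x \<and> v x \<le> w x" for v w :: "'a \<Rightarrow> real"
  proof -
    have vw: "0 < v x" "v x \<le> w x" "0 < w x" if "x \<in> K" for x
      using that vw0[of x] K by (auto simp: subset_iff)
    have "hint (\<lambda>x. (u x / w x)\<^sup>2) \<le> hint (\<lambda>x. (u x / v x)\<^sup>2)"
    proof (rule hint_mono)
      have "Cc K (\<lambda>x. (u x * (1 / w x))\<^sup>2)" "Cc K (\<lambda>x. (u x * (1 / v x))\<^sup>2)"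
        using vw by (intro Cc_power2 Cc_mult u_Cc continuous_on_divide continuous_on_const that; force)+
      then show "Cc K (\<lambda>x. (u x / w x)\<^sup>2)" "Cc K (\<lambda>x. (u x / v x)\<^sup>2)" by simp_all
      show "(u x / w x)\<^sup>2 \<le> (u x / v x)\<^sup>2" if "x \<in> K" for x
        unfolding power_divide using vw[OF that] by (intro divide_left_mono power_mono mult_pos_pos) auto
    qed
    then show ?thesis
      using hnorm2_eq_hint[of "\<lambda>x. u x / w x"] hnorm2_eq_hint[of "\<lambda>x. u x / v x"] off by simp
  qed
  have hc: "continuous_on K (\<lambda>x. hrho x)" by (rule continuous_K[OF continuous_on_hrho])
  have sc: "continuous_on K (\<lambda>x. sinh (hrho x))" by (intro continuous_intros hc)
  have le: "0 < hrho x" "hrho x \<le> sinh (hrho x)" "0 < sinh (hrho x)" if "x \<in> pball" for x :: 'a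
    using hrho_pos[OF that] arg_le_sinh[of "hrho x"] by auto
  show "hnorm2 (\<lambda>x. u x / (sinh (hrho x))\<^sup>2) \<le> hnorm2 (\<lambda>x. u x / (hrho x)\<^sup>2)"
  proof (rule mono)
    show "0 < (hrho x)\<^sup>2 \<and> (hrho x)\<^sup>2 \<le> (sinh (hrho x))\<^sup>2" if "x \<in> pball" for x :: 'a
      using le[OF that] by (simp add: power_mono)
  qed (intro continuous_intros hc sc)+
  show "hnorm2 (\<lambda>x. u x / (sinh (hrho x))\<^sup>2) \<le> hnorm2 (\<lambda>x. u x / (hrho x * sinh (hrho x)))"
  proof (rule mono)
    show "0 < hrho x * sinh (hrho x) \<and> hrho x * sinh (hrho x) \<le> (sinh (hrho x))\<^sup>2" if "x \<in> pball" for x :: 'a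
      using le[OF that] by (simp add: power2_eq_square)
  qed (intro continuous_intros hc sc)+
qed

theorem theorem1p7:
  fixes u :: "'a::euclidean_space \<Rightarrow> real"
  assumes "DIM('a) \<ge> 3" and "C2c_punct u"
  shows "(hnorm2 (hyp_laplacian u) \<ge>
      (real DIM('a) - 1) ^ 4 / 16 * hnorm2 u
    + (real DIM('a) - 1)\<^sup>2 / 8 * hnorm2 (\<lambda>x. u x / hrho x)
    + 9 / 16 * hnorm2 (\<lambda>x. u x / (hrho x)\<^sup>2)
    + ((real DIM('a))\<^sup>2 - 1) * (real DIM('a) - 3) * (real DIM('a) - 5) / 16
        * hnorm2 (\<lambda>x. u x / (sinh (hrho x))\<^sup>2)
    + ((real DIM('a))\<^sup>2 - 1) * (real DIM('a) - 3)\<^sup>2 / 8 * hnorm2 (\<lambda>x. u x / sinh (hrho x))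
    + (real DIM('a) - 1) * (real DIM('a) - 3) / 8 * hnorm2 (\<lambda>x. u x / (hrho x * sinh (hrho x)))) \<and>
    (\<forall>v :: real^3 \<Rightarrow> real. C2c_punct v \<longrightarrow>
      hnorm2 (hyp_laplacian v) \<ge> hnorm2 v + 1/2 * hnorm2 (\<lambda>x. v x / hrho x)
        + 9/16 * hnorm2 (\<lambda>x. v x / (hrho x)\<^sup>2)) \<and>
    (\<forall>w :: real^4 \<Rightarrow> real. C2c_punct w \<longrightarrow>
      hnorm2 (hyp_laplacian w) \<ge> 81/16 * hnorm2 w + 9/8 * hnorm2 (\<lambda>x. w x / hrho x)
        + 15/8 * hnorm2 (\<lambda>x. w x / sinh (hrho x)))"
proof (intro conjI allI impI)
  \<comment> \<open>In dimension 3 the factor \<open>n - 3\<close> removes the last three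
    terms.\<close>
  show "hnorm2 (hyp_laplacian v) \<ge> hnorm2 v + 1/2 * hnorm2 (\<lambda>x. v x / hrho x)
        + 9/16 * hnorm2 (\<lambda>x. v x / (hrho x)\<^sup>2)" if "C2c_punct v" for v :: "real^3 \<Rightarrow> real"
    using hyperbolic_rellich[of v] that by simp
  show "hnorm2 (hyp_laplacian w) \<ge> 81/16 * hnorm2 w + 9/8 * hnorm2 (\<lambda>x. w x / hrho x)
        + 15/8 * hnorm2 (\<lambda>x. w x / sinh (hrho x))" if w: "C2c_punct w" for w :: "real^4 \<Rightarrow> real"
    using hyperbolic_rellich[of w] w hnorm2_sinh_square_le[OF w] by simp
qed (rule hyperbolic_rellich[OF assms])

end
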